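(* Fix $\theta\in(-\frac{\pi}{2},\frac{\pi}{2})$. Then $\mathcal{A}_2=\mathcal{L}_\theta$, i.e., $D(\mathcal{A}_2)=\mathcal{D}(\mathcal{L}_\theta)$ and $\mathcal{A}_2\varphi=\mathcal{L}_\theta\varphi$ for all $\varphi\in\mathcal{D}(\mathcal{L}_\theta)$.
   Context: Write $z=x+\mathrm{i}y$ and identify $\mathbb{C}$ with $\mathbb{R}^2$. Let $d\gamma=\frac{1}{2\pi}e^{-(x^2+y^2)/2}\,dx\,dy$ and $L^p(\gamma)$ the complex $L^p$ spaces, with $\langle f,g\rangle=\int f\bar g\,d\gamma$ on $L^2(\gamma)$. For $m,n\in\mathbb{N}$ the complex Hermite polynomials are $$J_{m,n}(z)=(m!\,n!\,2^{m+n})^{-1/2}\sum_{r=0}^{m\wedge n}(-1)^r r!\,2^r\binom{m}{r}\binom{n}{r}z^{m-r}\bar z^{n-r},$$ an orthonormal basis of $L^2(\gamma)$. $\mathcal{L}_\theta$ has domain $\mathcal{D}(\mathcal{L}_\theta)=\{f\in L^2(\gamma):\sum_{m,n\ge0}(m^2+n^2+2mn\cos2\theta)|\langle f,J_{m,n}\rangle|^2<\infty\}$ and $\mathcal{L}_\theta f=-\sum_{m,n\ge0}[(m+n)\cos\theta+\mathrm{i}(m-n)\sin\theta]\langle f,J_{m,n}\rangle J_{m,n}$. For bounded continuous $\varphi$ on $\mathbb{R}^2$, $t\ge0$, $x\in\mathbb{C}$, $P_t\varphi(x)=\int_{\mathbb{C}}\varphi(e^{-(\cos\theta+\mathrm{i}\sin\theta)t}x+\sqrt{1-e^{-2t\cos\theta}}\,y)\,d\gamma(y)$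 (the semigroup of the complex Ornstein-Uhlenbeck process $dZ_t=-e^{\mathrm{i}\theta}Z_tdt+\sqrt{2\cos\theta}\,d\zeta_t$). $\{P_t\}$ extends uniquely to a strongly continuous contraction semigroup $\{T^2_t\}$ on $L^2(\gamma)$, and $\mathcal{A}_2$ is its infinitesimal generator. *)

theory Defs
  imports "HOL-Analysis.Analysis" "HOL-Probability.Probability"
begin

definition gauss :: "complex measure" where
  "gauss = density lborel (\<lambda>z. ennreal (exp (- ((cmod z)\<^sup>2) / 2) / (2 * pi)))"

text \<open>Membership in L^2(gamma) (complex valued); elements of L^2 are represented
  by functions, and equalities in L^2 are understood almost everywhere.\<close>
definition L2 :: "(complex \<Rightarrow> complex) \<Rightarrow> bool" where
  "L2 f \<longleftrightarrow> f \<in> borel_measurable gauss \<and> integrable gauss (\<lambda>z. (cmod (f z))\<^sup>2)"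

definition L2_norm :: "(complex \<Rightarrow> complex) \<Rightarrow> real" where
  "L2_norm f = sqrt (LINT z|gauss. (cmod (f z))\<^sup>2)"

definition L2_inner :: "(complex \<Rightarrow> complex) \<Rightarrow> (complex \<Rightarrow> complex) \<Rightarrow> complex" where
  "L2_inner f g = (LINT z|gauss. f z * cnj (g z))"

definition J :: "nat \<Rightarrow> nat \<Rightarrow> complex \<Rightarrow> complex" where
  "J m n z = complex_of_real ((fact m * fact n * 2 ^ (m + n)) powr (-1/2)) *
     (\<Sum>r = 0..min m n. complex_of_real ((-1) ^ r * fact r * 2 ^ r * real (m choose r) * real (n choose r))
        * z ^ (m - r) * (cnj z) ^ (n - r))"

text \<open>Eigenvalue multiplier: L_theta J_{m,n} = - lam theta m n J_{m,n}.\<close>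
definition lam :: "real \<Rightarrow> nat \<Rightarrow> nat \<Rightarrow> complex" where
  "lam \<theta> m n = complex_of_real (real (m + n) * cos \<theta>) + \<i> * complex_of_real ((real m - real n) * sin \<theta>)"

definition L_dom :: "real \<Rightarrow> (complex \<Rightarrow> complex) \<Rightarrow> bool" where
  "L_dom \<theta> f \<longleftrightarrow> L2 f \<and>
     (\<lambda>(m, n). (real m ^ 2 + real n ^ 2 + 2 * real m * real n * cos (2 * \<theta>)) * (cmod (L2_inner f (J m n)))\<^sup>2)
        summable_on (UNIV :: (nat \<times> nat) set)"

text \<open>L_op_is theta f g: g is (a representative of) L_theta f, i.e. the series
  -sum_{m,n} lam * <f,J_{m,n}> J_{m,n} converges unconditionally to g in L^2(gamma).\<close>
definition L_op_is :: "real \<Rightarrow> (complex \<Rightarrow> complex) \<Rightarrow> (complex \<Rightarrow> complex) \<Rightarrow> bool" where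
  "L_op_is \<theta> f g \<longleftrightarrow> L2 g \<and>
     (\<forall>\<epsilon>>0. \<exists>F0. finite F0 \<and> (\<forall>F. finite F \<and> F0 \<subseteq> F \<longrightarrow>
        L2_norm (\<lambda>z. g z - (\<Sum>(m, n)\<in>F. - lam \<theta> m n * L2_inner f (J m n) * J m n z)) < \<epsilon>))"

definition P :: "real \<Rightarrow> real \<Rightarrow> (complex \<Rightarrow> complex) \<Rightarrow> complex \<Rightarrow> complex" where
  "P \<theta> t \<phi> x = (LINT y|gauss. \<phi> (exp (- (complex_of_real (cos \<theta>) + \<i> * complex_of_real (sin \<theta>)) * complex_of_real t) * x
                       + complex_of_real (sqrt (1 - exp (- 2 * t * cos \<theta>))) * y))"

definition is_L2_extension_semigroup ::
  "real \<Rightarrow> (real \<Rightarrow> (complex \<Rightarrow> complex) \<Rightarrow> (complex \<Rightarrow> complex)) \<Rightarrow> bool" where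
  "is_L2_extension_semigroup \<theta> T \<longleftrightarrow>
     (\<forall>t\<ge>0. \<forall>f. L2 f \<longrightarrow> L2 (T t f)) \<and>
     (\<forall>t\<ge>0. \<forall>f g a b. L2 f \<longrightarrow> L2 g \<longrightarrow>
        (AE z in gauss. T t (\<lambda>w. a * f w + b * g w) z = a * T t f z + b * T t g z)) \<and>
     (\<forall>t\<ge>0. \<forall>f. L2 f \<longrightarrow> L2_norm (T t f) \<le> L2_norm f) \<and>
     (\<forall>f. L2 f \<longrightarrow> (AE z in gauss. T 0 f z = f z)) \<and>
     (\<forall>s\<ge>0. \<forall>t\<ge>0. \<forall>f. L2 f \<longrightarrow> (AE z in gauss. T (s + t) f z = T s (T t f) z)) \<and>
     (\<forall>f. L2 f \<longrightarrow> ((\<lambda>t. L2_norm (\<lambda>z. T t f z - f z)) \<longlongrightarrow> 0) (at_right 0)) \<and>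
     (\<forall>t\<ge>0. \<forall>\<phi>. continuous_on UNIV \<phi> \<longrightarrow> bounded (range \<phi>) \<longrightarrow>
        (AE z in gauss. T t \<phi> z = P \<theta> t \<phi> z))"

text \<open>Infinitesimal generator of T on L^2(gamma): gen_is T f g means f is in the
  domain and the generator applied to f is g (up to a.e. equality).\<close>
definition gen_is :: "(real \<Rightarrow> (complex \<Rightarrow> complex) \<Rightarrow> (complex \<Rightarrow> complex)) \<Rightarrow>
    (complex \<Rightarrow> complex) \<Rightarrow> (complex \<Rightarrow> complex) \<Rightarrow> bool" where
  "gen_is T f g \<longleftrightarrow> L2 f \<and> L2 g \<and>
     ((\<lambda>t. L2_norm (\<lambda>z. (T t f z - f z) / complex_of_real t - g z)) \<longlongrightarrow> 0) (at_right 0)"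

definition gen_dom :: "(real \<Rightarrow> (complex \<Rightarrow> complex) \<Rightarrow> (complex \<Rightarrow> complex)) \<Rightarrow>
    (complex \<Rightarrow> complex) \<Rightarrow> bool" where
  "gen_dom T f \<longleftrightarrow> (\<exists>g. gen_is T f g)"

end

theory Submission
  imports Defs
begin

text \<open>The polynomials \<open>J m n\<close> form an orthonormal basis, and Mehler's formula gives
  \<open>T t (J m n) = exp (- t * lam \<theta> m n) * J m n\<close>, first for truncations and then by contractivity
  of \<open>T t\<close> in the limit.  In coordinates \<open>T t\<close> is therefore multiplication by
  \<open>exp (- t * lam \<theta> m n)\<close>.  Since these eigenvalues have nonnegative real part, the difference
  quotient of the multiplier is dominated by \<open>cmod (lam \<theta> m n)\<close>, and dominated convergence in the
  sequence space identifies the generator with multiplication by \<open>- lam \<theta> m n\<close> on its maximal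
  domain.

  Completeness of the basis: a function orthogonal to all polynomials in \<open>Re z\<close> and \<open>Im z\<close> is
  integrated to zero over every rectangle, by applying the uniqueness of characteristic functions in
  one coordinate after the other.\<close>

section \<open>Moments of the Gaussian measure\<close>

text \<open>Functions represent their classes here, so the two operators can only be compared up to
  null sets; Fourier coefficients are the invariant that does this. For square-integrable f, both
  \<open>gen_is T f g\<close> and \<open>L_op_is \<theta> f g\<close> turn out to say that g is
  square-integrable with coefficients \<open>- lam \<theta> m n\<close> times those of f. The weight
  in \<open>L_dom\<close> is exactly the squared modulus of \<open>lam \<theta> m n\<close>, so the
  domain condition says that this prescribed sequence is square-summable, and Riesz-Fischer supplies
  g. The eigenvalue relation needs care because T is tied to the Mehler integral only on bounded
  continuous functions, whereas the eigenfunctions are unbounded. The Hermite algebra takes place in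
  the family exp(s D) applied to z^m (cnj z)^n, where D is the mixed derivative in z and its
  conjugate. Gaussian averaging shifts s, dilation rescales s, and at s = -2 the two effects cancel.
  The same family, run backwards, recovers the monomials from the J, which is how completeness
  reduces to a moment problem.\<close>

lemma lborel_complex:
  "(lborel :: complex measure) = distr (lborel \<Otimes>\<^sub>M lborel) borel (\<lambda>(x, y). Complex x y)"
proof (rule lborel_eqI)
  have [measurable]: "(\<lambda>(x, y). Complex x y) \<in> borel_measurable (lborel \<Otimes>\<^sub>M lborel)"
    by (subst borel_measurable_complex_iff) (simp add: case_prod_unfold)
  fix l u :: complex
  assume le: "\<And>b. b \<in> Basis \<Longrightarrow> l \<bullet> b \<le> u \<bullet> b"
  have *: "Re l \<le> Re u" "Im l \<le> Im u"
    using le[of 1] le[of \<i>] by (auto simp: Basis_complex_def)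
  have "emeasure (distr (lborel \<Otimes>\<^sub>M lborel) borel (\<lambda>(x, y). Complex x y)) (box l u)
      = emeasure (lborel \<Otimes>\<^sub>M lborel) ({Re l<..<Re u} \<times> {Im l<..<Im u})"
    by (subst emeasure_distr)
       (auto simp: in_box_complex_iff space_pair_measure intro!: arg_cong[where f="emeasure _"])
  also have "\<dots> = ennreal (Re u - Re l) * ennreal (Im u - Im l)"
    using * by (subst lborel.emeasure_pair_measure_Times) auto
  also have "\<dots> = ennreal (\<Prod>b\<in>Basis. (u - l) \<bullet> b)"
    using * by (simp add: Basis_complex_def ennreal_mult)
  finally show "emeasure (distr (lborel \<Otimes>\<^sub>M lborel) borel (\<lambda>(x, y). Complex x y)) (box l u)
      = ennreal (\<Prod>b\<in>Basis. (u - l) \<bullet> b)" .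
qed simp

lemma measurable_Complex [measurable]:
  "(\<lambda>(x, y). Complex x y) \<in> borel_measurable (borel \<Otimes>\<^sub>M borel)"
  by (subst borel_measurable_complex_iff) (simp add: case_prod_unfold)

text \<open>The squared modulus is a sum of two squares, so the density factors into two standard
  normal densities. One-dimensional normal moments and Fubini become available through this
  form.\<close>

lemma gauss_eq_distr:
  "gauss = distr (std_normal_distribution \<Otimes>\<^sub>M std_normal_distribution) borel (\<lambda>(x, y). Complex x y)"
proof -
  have "std_normal_distribution \<Otimes>\<^sub>M std_normal_distribution =
      density (lborel \<Otimes>\<^sub>M lborel) (\<lambda>(x, y). ennreal (std_normal_density x) * ennreal (std_normal_density y))"
    by (rule pair_measure_density)
       (auto intro!: prob_space_imp_sigma_finite prob_space_normal_density lborel.sigma_finite_measure_axioms)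
  also have "\<dots> = density (lborel \<Otimes>\<^sub>M lborel)
      (\<lambda>z. ennreal (exp (- ((cmod (case z of (x, y) \<Rightarrow> Complex x y))\<^sup>2) / 2) / (2 * pi)))"
    by (intro arg_cong[where f="density _"] ext)
       (auto simp: normal_density_def cmod_def ennreal_mult[symmetric] exp_add[symmetric]
         add_divide_distrib diff_divide_distrib real_sqrt_mult[symmetric])
  finally have N: "std_normal_distribution \<Otimes>\<^sub>M std_normal_distribution = \<dots>" .
  show ?thesis
    unfolding gauss_def lborel_complex N
    by (rule density_distr) simp_all
qed

lemma space_gauss [simp]: "space gauss = UNIV"
  and sets_gauss [simp, measurable_cong]: "sets gauss = sets borel"
  by (simp_all add: gauss_def)

lemma prob_space_gauss: "prob_space gauss"
  unfolding gauss_eq_distr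
proof (rule prob_space.prob_space_distr)
  interpret N: prob_space std_normal_distribution by (rule prob_space_normal_density) simp
  interpret pair_prob_space std_normal_distribution std_normal_distribution ..
  show "prob_space (std_normal_distribution \<Otimes>\<^sub>M std_normal_distribution)"
    by unfold_locales
qed measurable

interpretation gauss: prob_space gauss
  by (rule prob_space_gauss)

lemma has_bochner_integral_gauss_mult:
  fixes f g :: "real \<Rightarrow> real"
  assumes f: "has_bochner_integral lborel (\<lambda>x. std_normal_density x * f x) a"
    and g: "has_bochner_integral lborel (\<lambda>x. std_normal_density x * g x) b"
    and [measurable]: "f \<in> borel_measurable borel" "g \<in> borel_measurable borel"
  shows "has_bochner_integral gauss (\<lambda>z. f (Re z) * g (Im z)) (a * b)"
proof -
  let ?N = "std_normal_distribution"
  interpret N: prob_space ?N by (rule prob_space_normal_density) simp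
  interpret pair_prob_space ?N ?N ..
  have f': "has_bochner_integral ?N f a" and g': "has_bochner_integral ?N g b"
    using f g by (auto intro!: has_bochner_integral_density)
  have i: "integrable (?N \<Otimes>\<^sub>M ?N) (\<lambda>(x, y). f x * g y)"
    by (rule Fubini_integrable)
       (use f' g' in \<open>auto simp: has_bochner_integral_iff abs_mult\<close>)
  have "(LINT z|(?N \<Otimes>\<^sub>M ?N). (\<lambda>(x, y). f x * g y) z) = a * b"
    using integral_fst'[OF i] f' g' by (simp add: has_bochner_integral_iff)
  with i show ?thesis
    unfolding gauss_eq_distr
    by (intro has_bochner_integral_distr) (auto simp: has_bochner_integral_iff case_prod_unfold)
qed

definition std_moment :: "nat \<Rightarrow> real" where
  "std_moment k = (LINT x|lborel. std_normal_density x * x ^ k)"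

lemma std_moment_even: "std_moment (2 * k) = fact (2 * k) / (2 ^ k * fact k)"
  unfolding std_moment_def by (rule integral_std_normal_moment_even)

lemma std_moment_odd: "odd k \<Longrightarrow> std_moment k = 0"
  unfolding std_moment_def by (metis integral_std_normal_moment_odd oddE)

lemma has_bochner_integral_gauss_monomial:
  "has_bochner_integral gauss (\<lambda>z. Re z ^ i * Im z ^ j) (std_moment i * std_moment j)"
  by (rule has_bochner_integral_gauss_mult)
     (auto simp: has_bochner_integral_iff integrable_std_normal_moment std_moment_def)

text \<open>Exponential moments are what makes the moment problem determinate in the completeness
  proof. The absolute value is handled by bounding with the sum of the exponentials for c and
  -c.\<close>

lemma integrable_std_normal_exp_abs:
  fixes c :: real
  assumes "0 \<le> c"
  shows "integrable lborel (\<lambda>x. std_normal_density x * exp (c * \<bar>x\<bar>))"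
proof (rule Bochner_Integration.integrable_bound)
  \<comment> \<open>Completing the square: an exponential tilt of the standard normal density is a
    multiple of the density with mean d.\<close>
  have *: "std_normal_density x * exp (d * x) = exp (d\<^sup>2 / 2) * normal_density d 1 x" for d x :: real
    by (simp add: normal_density_def exp_add[symmetric] exp_diff[symmetric] power2_eq_square field_simps)
  have "integrable lborel (\<lambda>x. exp (c\<^sup>2 / 2) * normal_density c 1 x + exp ((-c)\<^sup>2 / 2) * normal_density (-c) 1 x)"
    by (intro Bochner_Integration.integrable_add integrable_mult_right integrable_normal_density) auto
  then show "integrable lborel (\<lambda>x. std_normal_density x * exp (c * x) + std_normal_density x * exp (- c * x))"
    unfolding * .
  show "AE x in lborel. norm (std_normal_density x * exp (c * \<bar>x\<bar>))
      \<le> norm (std_normal_density x * exp (c * x) + std_normal_density x * exp (- c * x))"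
  proof (rule AE_I2)
    fix x :: real
    have "exp (c * \<bar>x\<bar>) \<le> exp (c * x) + exp (- c * x)"
      by (auto simp: abs_if)
    from mult_left_mono[OF this, of "std_normal_density x"]
    show "norm (std_normal_density x * exp (c * \<bar>x\<bar>))
      \<le> norm (std_normal_density x * exp (c * x) + std_normal_density x * exp (- c * x))"
      by (simp add: abs_mult distrib_left)
  qed
qed simp

lemma integrable_gauss_exp_abs:
  assumes "0 \<le> c" "0 \<le> d"
  shows "integrable gauss (\<lambda>z. exp (c * \<bar>Re z\<bar>) * exp (d * \<bar>Im z\<bar>))"
proof -
  have "\<exists>r. has_bochner_integral gauss (\<lambda>z. exp (c * \<bar>Re z\<bar>) * exp (d * \<bar>Im z\<bar>)) r"
    by (rule exI, rule has_bochner_integral_gauss_mult)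
       (auto intro!: has_bochner_integral_integrable integrable_std_normal_exp_abs assms)
  then show ?thesis
    by (auto simp: has_bochner_integral_iff)
qed

text \<open>The moments of \<^term>\<open>z\<close> and its conjugate are read off as the coefficients in
  \<open>u\<close> of this identity for \<open>a = u + 1\<close> and \<open>b = \<i> * (u - 1)\<close>.\<close>
lemma gauss_linear_form_moment:
  fixes a b :: complex
  shows "has_bochner_integral gauss (\<lambda>z. (a * Re z + b * Im z) ^ k)
    (if even k then std_moment k * (a\<^sup>2 + b\<^sup>2) ^ (k div 2) else 0)"
proof -
  have "has_bochner_integral gauss
      (\<lambda>z. \<Sum>i\<le>k. (of_nat (k choose i) * a ^ i * b ^ (k - i)) * complex_of_real (Re z ^ i * Im z ^ (k - i)))
      (\<Sum>i\<le>k. (of_nat (k choose i) * a ^ i * b ^ (k - i)) * complex_of_real (std_moment i * std_moment (k - i)))"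
    by (intro has_bochner_integral_sum has_bochner_integral_mult_right has_bochner_integral_of_real
        has_bochner_integral_gauss_monomial)
  moreover have "(\<lambda>z. \<Sum>i\<le>k. (of_nat (k choose i) * a ^ i * b ^ (k - i)) * complex_of_real (Re z ^ i * Im z ^ (k - i)))
     = (\<lambda>z. (a * Re z + b * Im z) ^ k)"
    by (simp add: binomial_ring power_mult_distrib ac_simps)
  moreover have "(\<Sum>i\<le>k. (of_nat (k choose i) * a ^ i * b ^ (k - i)) * complex_of_real (std_moment i * std_moment (k - i)))
     = (if even k then std_moment k * (a\<^sup>2 + b\<^sup>2) ^ (k div 2) else 0)"
  proof (cases "even k")
    case False
    \<comment> \<open>For odd k one of i and k - i is odd.\<close>
    have "std_moment i * std_moment (k - i) = 0" if "i \<le> k" for i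
      using False that by (cases "even i") (auto simp: std_moment_odd)
    then show ?thesis using False by (auto intro!: sum.neutral)
  next
    case True
    then obtain n where k: "k = 2 * n" by auto
    have "(\<Sum>i\<le>k. (of_nat (k choose i) * a ^ i * b ^ (k - i)) * complex_of_real (std_moment i * std_moment (k - i)))
      = (\<Sum>i\<in>(\<lambda>j. 2 * j) ` {..n}. (of_nat (k choose i) * a ^ i * b ^ (k - i)) * complex_of_real (std_moment i * std_moment (k - i)))"
    proof (rule sum.mono_neutral_right)
      show "\<forall>i\<in>{..k} - (\<lambda>j. 2 * j) ` {..n}. (of_nat (k choose i) * a ^ i * b ^ (k - i)) * complex_of_real (std_moment i * std_moment (k - i)) = 0"
      proof
        fix i assume "i \<in> {..k} - (\<lambda>j. 2 * j) ` {..n}"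
        then have "odd i" unfolding k by (auto elim!: evenE)
        then show "(of_nat (k choose i) * a ^ i * b ^ (k - i)) * complex_of_real (std_moment i * std_moment (k - i)) = 0"
          by (simp add: std_moment_odd)
      qed
    qed (auto simp: k)
    also have "\<dots> = (\<Sum>j\<le>n. of_real (real (2 * n choose (2 * j)) * (std_moment (2 * j) * std_moment (2 * (n - j)))) * ((a\<^sup>2) ^ j * (b\<^sup>2) ^ (n - j)))"
      unfolding k by (subst sum.reindex) (auto simp: inj_on_def power_mult[symmetric] diff_mult_distrib2[symmetric] intro!: sum.cong)
    also have "\<dots> = (\<Sum>j\<le>n. of_real (std_moment (2 * n) * real (n choose j)) * ((a\<^sup>2) ^ j * (b\<^sup>2) ^ (n - j)))"
    proof (rule sum.cong[OF refl])
      fix j assume "j \<in> {..n}"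
      then have j: "j \<le> n" by simp
      \<comment> \<open>The factorials of 2j and 2(n - j) in the moments cancel those in the
        binomial coefficient, leaving that of n over j.\<close>
      have "real (2 * n choose (2 * j)) = fact (2 * n) / (fact (2 * j) * fact (2 * (n - j)))"
        using binomial_fact[of "2 * j" "2 * n"] j by (simp add: diff_mult_distrib2)
      moreover have "real (n choose j) = fact n / (fact j * fact (n - j))"
        using binomial_fact[of j n] j by simp
      moreover have "(2::real) ^ n = 2 ^ j * 2 ^ (n - j)"
        using j by (simp add: power_add[symmetric])
      ultimately have "real (2 * n choose (2 * j)) * (std_moment (2 * j) * std_moment (2 * (n - j))) =
          std_moment (2 * n) * real (n choose j)"
        unfolding std_moment_even by (simp add: divide_simps)
      then show "complex_of_real (real (2 * n choose (2 * j)) * (std_moment (2 * j) * std_moment (2 * (n - j)))) * ((a\<^sup>2) ^ j * (b\<^sup>2) ^ (n - j)) =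
        of_real (std_moment (2 * n) * real (n choose j)) * ((a\<^sup>2) ^ j * (b\<^sup>2) ^ (n - j))"
        by (simp only:)
    qed
    also have "\<dots> = std_moment k * (a\<^sup>2 + b\<^sup>2) ^ n"
      by (simp add: k binomial_ring sum_distrib_left mult_ac)
    finally show ?thesis using True by (simp add: k)
  qed
  ultimately show ?thesis by simp
qed

lemma integrable_gauss_Re_Im_polynomial:
  "integrable gauss (\<lambda>z. (a * complex_of_real (Re z) + b * complex_of_real (Im z)) ^ p *
      (c * complex_of_real (Re z) + d * complex_of_real (Im z)) ^ q)"
proof -
  have "integrable gauss (\<lambda>z. \<Sum>i\<le>p. \<Sum>j\<le>q.
     (of_nat (p choose i) * of_nat (q choose j) * a ^ i * b ^ (p - i) * c ^ j * d ^ (q - j)) *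
      complex_of_real (Re z ^ i * Re z ^ j * Im z ^ (p - i) * Im z ^ (q - j)))"
    by (intro Bochner_Integration.integrable_sum integrable_mult_right integrable_of_real)
       (use has_bochner_integral_gauss_monomial[of "i + j" "(p - i) + (q - j)" for i j] in
         \<open>auto simp: has_bochner_integral_iff power_add mult.assoc\<close>)
  then show ?thesis
    unfolding binomial_ring sum_product by (simp add: power_mult_distrib ac_simps power_add)
qed

lemma integrable_gauss_monomial: "integrable gauss (\<lambda>z. z ^ p * cnj z ^ q)"
proof -
  have "1 * complex_of_real (Re z) + \<i> * Im z = z" "1 * complex_of_real (Re z) + - \<i> * Im z = cnj z" for z
    by (simp_all add: complex_eq_iff)
  then show ?thesis
    using integrable_gauss_Re_Im_polynomial[of 1 \<i> p 1 "-\<i>" q] by (simp only:)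
qed

text \<open>The integral of \<open>(u * z + cnj z) ^ k\<close> is a polynomial in u whose
  coefficients are all moments of total degree k at once; evaluating it in closed form and comparing
  coefficients isolates each moment.\<close>

lemma integral_gauss_monomial:
  "(LINT z|gauss. z ^ p * cnj z ^ q) = (if p = q then 2 ^ p * fact p else 0)"
proof -
  define k where "k = p + q"
  define c where "c i = of_nat (k choose i) * (LINT z|gauss. z ^ i * cnj z ^ (k - i))" for i
  define d :: "nat \<Rightarrow> complex" where
    "d i = (if even k \<and> i = k div 2 then std_moment k * 4 ^ (k div 2) else 0)" for i
  have "(\<Sum>i\<le>k. c i * u ^ i) = (\<Sum>i\<le>k. d i * u ^ i)" for u
  proof -
    have "(\<Sum>i\<le>k. c i * u ^ i) = (LINT z|gauss. (\<Sum>i\<le>k. of_nat (k choose i) * u ^ i * (z ^ i * cnj z ^ (k - i))))"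
      by (subst Bochner_Integration.integral_sum)
         (auto simp: c_def mult_ac(1,2) integrable_gauss_monomial intro!: integrable_mult_right sum.cong)
    also have "\<dots> = (LINT z|gauss. (u * z + cnj z) ^ k)"
      unfolding binomial_ring by (simp add: power_mult_distrib ac_simps)
    also have "\<dots> = (LINT z|gauss. ((u + 1) * Re z + (\<i> * (u - 1)) * Im z) ^ k)"
      by (intro Bochner_Integration.integral_cong refl arg_cong[where f="\<lambda>x. x ^ k"])
         (auto simp: complex_eq_iff algebra_simps)
    also have "\<dots> = (if even k then std_moment k * ((u + 1)\<^sup>2 + (\<i> * (u - 1))\<^sup>2) ^ (k div 2) else 0)"
      by (rule has_bochner_integral_integral_eq[OF gauss_linear_form_moment])
    \<comment> \<open>Because the two squares combine to a multiple of u alone, the closed form is a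
      single power of u: only the middle coefficient is nonzero, hence the case distinction
      \<open>p = q\<close>.\<close>
    also have "(u + 1)\<^sup>2 + (\<i> * (u - 1))\<^sup>2 = 4 * u"
      by (simp add: power2_eq_square algebra_simps)
    also have "(if even k then std_moment k * (4 * u) ^ (k div 2) else 0) = (\<Sum>i\<le>k. d i * u ^ i)"
      by (auto simp: d_def power_mult_distrib if_distrib[where f="\<lambda>x. x * _"]
          if_distrib[where f=complex_of_real] sum.delta cong: if_cong)
    finally show ?thesis .
  qed
  then have "c p = d p"
    using polyfun_eq_coeffs[of c k d] by (auto simp: k_def)
  moreover have "p = k div 2 \<and> even k \<longleftrightarrow> p = q"
    unfolding k_def by presburger
  ultimately have *: "of_nat ((p + q) choose p) * (LINT z|gauss. z ^ p * cnj z ^ q) =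
      (if p = q then std_moment (2 * p) * 4 ^ p else 0)"
    by (auto simp: c_def d_def k_def mult_2)
  show ?thesis
  proof (cases "p = q")
    case False
    then show ?thesis using * by (simp add: binomial_eq_0_iff)
  next
    case True
    have 1: "of_nat ((p + p) choose p) = (fact (2 * p) / (fact p * fact p) :: complex)"
      using binomial_fact[of p "p + p", where 'a=complex] by (simp add: mult_2)
    have 2: "complex_of_real (std_moment (2 * p)) = fact (2 * p) / (2 ^ p * fact p)"
      by (simp add: std_moment_even)
    have 3: "(4::complex) ^ p = 2 ^ p * 2 ^ p"
      by (simp add: power_mult_distrib[symmetric])
    have "(fact (2 * p) / (fact p * fact p)) * (LINT z|gauss. z ^ p * cnj z ^ p) =
        (fact (2 * p) / (2 ^ p * fact p)) * (2 ^ p * 2 ^ p)"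
      using * True unfolding 1[symmetric] 2[symmetric] 3[symmetric] by simp
    then show ?thesis
      using True by (simp add: field_simps)
  qed
qed

section \<open>The Hilbert space structure of the square-integrable functions\<close>

lemma borel_measurable_cnj [measurable]: "cnj \<in> borel_measurable borel"
  by (intro borel_measurable_continuous_onI continuous_intros)

lemma L2_measurable [measurable_dest]: "L2 f \<Longrightarrow> f \<in> borel_measurable borel"
  by (simp add: L2_def cong: measurable_cong_sets)

lemma L2_integrable: "L2 f \<Longrightarrow> integrable gauss (\<lambda>z. (cmod (f z))\<^sup>2)"
  by (simp add: L2_def)

lemma L2I: "f \<in> borel_measurable borel \<Longrightarrow> integrable gauss (\<lambda>z. (cmod (f z))\<^sup>2) \<Longrightarrow> L2 f"
  by (simp add: L2_def cong: measurable_cong_sets)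

lemma L2_integrable_norm_mult:
  assumes f: "L2 f" and g: "L2 g"
  shows "integrable gauss (\<lambda>z. cmod (f z) * cmod (g z))"
proof (rule Bochner_Integration.integrable_bound)
  note [measurable] = L2_measurable[OF f] L2_measurable[OF g]
  show "integrable gauss (\<lambda>z. (cmod (f z))\<^sup>2 + (cmod (g z))\<^sup>2)"
    using f g by (intro Bochner_Integration.integrable_add L2_integrable)
  show "AE z in gauss. norm (cmod (f z) * cmod (g z)) \<le> norm ((cmod (f z))\<^sup>2 + (cmod (g z))\<^sup>2)"
  proof (rule AE_I2)
    fix z
    show "norm (cmod (f z) * cmod (g z)) \<le> norm ((cmod (f z))\<^sup>2 + (cmod (g z))\<^sup>2)"
      using sum_squares_bound[of "cmod (f z)" "cmod (g z)"] mult_nonneg_nonneg[of "cmod (f z)" "cmod (g z)"]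
      by (simp add: abs_mult del: mult_nonneg_nonneg)
  qed
qed (use f g in measurable)

lemma L2_integrable_mult:
  assumes f: "L2 f" and g: "L2 g"
  shows "integrable gauss (\<lambda>z. f z * g z)" "integrable gauss (\<lambda>z. f z * cnj (g z))"
proof -
  note [measurable] = L2_measurable[OF f] L2_measurable[OF g]
  show "integrable gauss (\<lambda>z. f z * g z)" "integrable gauss (\<lambda>z. f z * cnj (g z))"
    by (rule Bochner_Integration.integrable_bound[OF L2_integrable_norm_mult[OF f g]],
        measurable, simp add: norm_mult)+
qed

lemma L2_cmult: "L2 f \<Longrightarrow> L2 (\<lambda>z. a * f z)"
  by (auto intro!: L2I simp: norm_mult power_mult_distrib L2_integrable dest: L2_measurable)

lemma L2_add:
  assumes f: "L2 f" and g: "L2 g"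
  shows "L2 (\<lambda>z. f z + g z)"
proof (rule L2I)
  note [measurable] = L2_measurable[OF f] L2_measurable[OF g]
  show "(\<lambda>z. f z + g z) \<in> borel_measurable borel" by measurable
  show "integrable gauss (\<lambda>z. (cmod (f z + g z))\<^sup>2)"
  proof (rule Bochner_Integration.integrable_bound)
    show "integrable gauss (\<lambda>z. 2 * (cmod (f z))\<^sup>2 + 2 * (cmod (g z))\<^sup>2)"
      using f g by (intro Bochner_Integration.integrable_add integrable_mult_right L2_integrable)
    show "AE z in gauss. norm ((cmod (f z + g z))\<^sup>2) \<le> norm (2 * (cmod (f z))\<^sup>2 + 2 * (cmod (g z))\<^sup>2)"
    proof (rule AE_I2)
      fix z
      have "(cmod (f z + g z))\<^sup>2 \<le> (cmod (f z) + cmod (g z))\<^sup>2"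
        by (intro power_mono norm_triangle_ineq) auto
      also have "\<dots> \<le> 2 * (cmod (f z))\<^sup>2 + 2 * (cmod (g z))\<^sup>2"
        using sum_squares_bound[of "cmod (f z)" "cmod (g z)"] by (simp add: power2_sum)
      finally show "norm ((cmod (f z + g z))\<^sup>2) \<le> norm (2 * (cmod (f z))\<^sup>2 + 2 * (cmod (g z))\<^sup>2)"
        by simp
    qed
  qed measurable
qed

lemma L2_diff: "L2 f \<Longrightarrow> L2 g \<Longrightarrow> L2 (\<lambda>z. f z - g z)"
  using L2_add[of f "\<lambda>z. (-1) * g z"] L2_cmult[of g "-1"] by simp

lemma L2_bounded:
  assumes "f \<in> borel_measurable borel" "\<And>z. cmod (f z) \<le> B"
  shows "L2 f"
proof (rule L2I)
  show "integrable gauss (\<lambda>z. (cmod (f z))\<^sup>2)"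
    by (rule gauss.integrable_const_bound[where B="B\<^sup>2"])
       (use assms in \<open>auto intro!: power_mono\<close>)
qed fact

lemma L2_const: "L2 (\<lambda>z. c)"
  by (rule L2_bounded[where B="cmod c"]) auto

lemma L2_norm_one: "L2_norm (\<lambda>z. 1) = 1"
  using gauss.prob_space by (simp add: L2_norm_def)

lemma L2_sum: "(\<And>k. k \<in> F \<Longrightarrow> L2 (f k)) \<Longrightarrow> L2 (\<lambda>z. \<Sum>k\<in>F. f k z)"
  by (induction F rule: infinite_finite_induct)
     (simp_all add: L2_add, simp_all add: L2_bounded[where B=0])

lemma L2_norm_nonneg [simp]: "0 \<le> L2_norm f"
  by (simp add: L2_norm_def)

lemma L2_norm_power2: "(L2_norm f)\<^sup>2 = (LINT z|gauss. (cmod (f z))\<^sup>2)"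
  by (simp add: L2_norm_def)

lemma L2_norm_cong_AE:
  assumes "L2 f" "L2 g" "AE z in gauss. f z = g z"
  shows "L2_norm f = L2_norm g"
proof -
  note [measurable] = L2_measurable[OF assms(1)] L2_measurable[OF assms(2)]
  have "(LINT z|gauss. (cmod (f z))\<^sup>2) = (LINT z|gauss. (cmod (g z))\<^sup>2)"
    by (rule integral_cong_AE) (use assms(3) in auto)
  then show ?thesis by (simp add: L2_norm_def)
qed

lemma L2_inner_cong_AE:
  assumes "L2 f" "L2 g" "L2 h" "AE z in gauss. f z = g z"
  shows "L2_inner f h = L2_inner g h"
proof -
  note [measurable] = L2_measurable[OF assms(1)] L2_measurable[OF assms(2)] L2_measurable[OF assms(3)]
  show ?thesis
    unfolding L2_inner_def by (rule integral_cong_AE) (use assms(4) in auto)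
qed

lemma L2_inner_self: "L2_inner f f = (L2_norm f)\<^sup>2"
  unfolding L2_inner_def L2_norm_power2 complex_norm_square[symmetric]
  by (rule integral_complex_of_real)

lemma L2_inner_commute: "L2_inner g f = cnj (L2_inner f g)"
  unfolding L2_inner_def by (subst Bochner_Integration.integral_cnj[symmetric]) (simp add: mult.commute)

lemma L2_inner_add_left: "L2 f \<Longrightarrow> L2 g \<Longrightarrow> L2 h \<Longrightarrow>
    L2_inner (\<lambda>z. f z + g z) h = L2_inner f h + L2_inner g h"
  unfolding L2_inner_def by (simp add: distrib_right L2_integrable_mult)

lemma L2_inner_diff_left: "L2 f \<Longrightarrow> L2 g \<Longrightarrow> L2 h \<Longrightarrow>
    L2_inner (\<lambda>z. f z - g z) h = L2_inner f h - L2_inner g h"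
  unfolding L2_inner_def by (simp add: left_diff_distrib L2_integrable_mult)

lemma L2_inner_cmult_left: "L2_inner (\<lambda>z. a * f z) h = a * L2_inner f h"
  unfolding L2_inner_def by (simp add: mult.assoc)

lemma L2_inner_sum_left:
  "(\<And>k. k \<in> F \<Longrightarrow> L2 (f k)) \<Longrightarrow> L2 h \<Longrightarrow>
    L2_inner (\<lambda>z. \<Sum>k\<in>F. f k z) h = (\<Sum>k\<in>F. L2_inner (f k) h)"
  by (induction F rule: infinite_finite_induct)
     (simp_all add: L2_inner_add_left L2_sum, simp_all add: L2_inner_def)

lemma L2_norm_diff_power2:
  assumes "L2 f" "L2 g"
  shows "(L2_norm (\<lambda>z. f z - g z))\<^sup>2 = (L2_norm f)\<^sup>2 - 2 * Re (L2_inner f g) + (L2_norm g)\<^sup>2"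
proof -
  have "complex_of_real ((L2_norm (\<lambda>z. f z - g z))\<^sup>2) = L2_inner (\<lambda>z. f z - g z) (\<lambda>z. f z - g z)"
    by (simp add: L2_inner_self)
  also have "\<dots> = L2_inner f (\<lambda>z. f z - g z) - L2_inner g (\<lambda>z. f z - g z)"
    by (simp add: L2_inner_diff_left L2_diff assms)
  also have "\<dots> = cnj (L2_inner (\<lambda>z. f z - g z) f) - cnj (L2_inner (\<lambda>z. f z - g z) g)"
    by (simp only: L2_inner_commute[symmetric])
  also have "\<dots> = L2_inner f f - cnj (L2_inner g f) - cnj (L2_inner f g) + L2_inner g g"
    by (simp add: L2_inner_diff_left assms L2_inner_self)
  also have "cnj (L2_inner g f) = L2_inner f g"
    by (rule L2_inner_commute[symmetric])
  finally have "complex_of_real ((L2_norm (\<lambda>z. f z - g z))\<^sup>2) =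
     of_real ((L2_norm f)\<^sup>2) - L2_inner f g - cnj (L2_inner f g) + of_real ((L2_norm g)\<^sup>2)"
    unfolding L2_inner_self .
  from arg_cong[OF this, of Re] show ?thesis
    by simp
qed

text \<open>Proved for the product of moduli, not just for the inner product, since with g = 1 it
  bounds the L1 norm by the L2 norm, as the completeness of L2 requires.\<close>

lemma L2_Cauchy_Schwarz_norm:
  assumes f: "L2 f" and g: "L2 g"
  shows "(LINT z|gauss. cmod (f z) * cmod (g z)) \<le> L2_norm f * L2_norm g"
proof -
  define A where "A = (L2_norm f)\<^sup>2"
  define B where "B = (L2_norm g)\<^sup>2"
  define I where "I = (LINT z|gauss. cmod (f z) * cmod (g z))"
  have quad: "0 \<le> s\<^sup>2 * A - 2 * s * I + B" for s
  proof -
    have "0 \<le> (LINT z|gauss. (s * cmod (f z) - cmod (g z))\<^sup>2)"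
      by simp
    also have "(\<lambda>z. (s * cmod (f z) - cmod (g z))\<^sup>2) =
        (\<lambda>z. s\<^sup>2 * (cmod (f z))\<^sup>2 - (2 * s) * (cmod (f z) * cmod (g z)) + (cmod (g z))\<^sup>2)"
      by (simp add: fun_eq_iff power2_diff power_mult_distrib)
    also have "(LINT z|gauss. \<dots> z) = s\<^sup>2 * A - 2 * s * I + B"
      using L2_integrable[OF f] L2_integrable[OF g] L2_integrable_norm_mult[OF f g]
      by (simp add: A_def B_def I_def L2_norm_power2)
    finally show ?thesis .
  qed
  have A: "0 \<le> A" and B: "0 \<le> B"
    by (simp_all add: A_def B_def)
  have "I\<^sup>2 \<le> A * B"
  proof (cases "A = 0")
    case True
    have "I = 0"
    proof (rule ccontr)
      assume "I \<noteq> 0"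
      \<comment> \<open>With A = 0 the quadratic is the linear function B - 2sI, and this s gives it
        the value -1.\<close>
      with quad[of "(B + 1) / (2 * I)"] True show False by simp
    qed
    with True show ?thesis by simp
  next
    case False
    with A have "0 < A" by simp
    \<comment> \<open>The minimiser of the quadratic.\<close>
    with quad[of "I / A"] show ?thesis
      by (simp add: field_simps power2_eq_square)
  qed
  then have "I\<^sup>2 \<le> (L2_norm f * L2_norm g)\<^sup>2"
    by (simp add: A_def B_def power_mult_distrib)
  then show ?thesis
    unfolding I_def by (rule power2_le_imp_le) simp
qed

lemma L2_Cauchy_Schwarz:
  assumes "L2 f" "L2 g"
  shows "cmod (L2_inner f g) \<le> L2_norm f * L2_norm g"
proof -
  have "cmod (L2_inner f g) \<le> (LINT z|gauss. cmod (f z * cnj (g z)))"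
    unfolding L2_inner_def by (rule integral_norm_bound)
  then show ?thesis
    using L2_Cauchy_Schwarz_norm[OF assms] by (simp add: norm_mult)
qed

text \<open>A fast subsequence has increments that are summable in L2, hence in L1, so it converges
  almost everywhere. Fatou's lemma then transfers the Cauchy estimate to the limit and covers the
  whole sequence.\<close>

lemma L2_complete:
  assumes S: "\<And>n. L2 (S n)"
    and Cauchy: "\<And>e::real. 0 < e \<Longrightarrow> \<exists>N::nat. \<forall>m\<ge>N. \<forall>n\<ge>N. L2_norm (\<lambda>z. S m z - S n z) < e"
  shows "\<exists>g. L2 g \<and> (\<lambda>n. L2_norm (\<lambda>z. g z - S n z)) \<longlonglongrightarrow> 0"
proof -
  note [measurable] = L2_measurable[OF S]
  have "\<exists>N. \<forall>k. \<forall>m\<ge>N k. \<forall>n\<ge>N k. L2_norm (\<lambda>z. S m z - S n z) < (1/2) ^ k"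
    by (rule choice) (use Cauchy in auto)
  then obtain N where N: "\<And>k m n. m \<ge> N k \<Longrightarrow> n \<ge> N k \<Longrightarrow> L2_norm (\<lambda>z. S m z - S n z) < (1/2) ^ k"
    by blast
  \<comment> \<open>Summing the thresholds makes r monotone and at least \<open>N k\<close>; the
    summand k makes it unbounded, which the Fatou step needs.\<close>
  define r where "r k = (\<Sum>i\<le>k. N i) + k" for k
  have rN: "N k \<le> r k" for k
    unfolding r_def by (intro trans_le_add1 member_le_sum) auto
  have r_Suc: "r k \<le> r (Suc k)" and r_ge: "k \<le> r k" for k
    by (auto simp: r_def)
  define D where "D k z = S (r (Suc k)) z - S (r k) z" for k z
  have L2D: "L2 (D k)" for k
    unfolding D_def by (intro L2_diff S)
  note [measurable] = L2_measurable[OF L2D]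
  have D_le: "(LINT z|gauss. cmod (D k z)) \<le> (1/2) ^ k" for k
  proof -
    have "(LINT z|gauss. cmod (D k z)) \<le> L2_norm (D k) * L2_norm (\<lambda>z. 1)"
      using L2_Cauchy_Schwarz_norm[OF L2D[of k] L2_const[of 1]] by simp
    also have "\<dots> = L2_norm (D k)"
      by (simp add: L2_norm_one)
    also have "\<dots> < (1/2) ^ k"
      unfolding D_def by (rule N[OF order.trans[OF rN r_Suc] rN])
    finally show ?thesis by simp
  qed
  have iD: "integrable gauss (\<lambda>z. cmod (D k z))" for k
    using L2_integrable_norm_mult[OF L2D[of k] L2_const[of 1]] by simp
  have "(\<integral>\<^sup>+z. (\<Sum>k. ennreal (cmod (D k z))) \<partial>gauss) = (\<Sum>k. \<integral>\<^sup>+z. ennreal (cmod (D k z)) \<partial>gauss)"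
    by (rule nn_integral_suminf) measurable
  also have "\<dots> = (\<Sum>k. ennreal (LINT z|gauss. cmod (D k z)))"
    by (intro suminf_cong nn_integral_eq_integral iD) auto
  also have "\<dots> \<le> (\<Sum>k. ennreal ((1/2) ^ k))"
    by (intro suminf_le ennreal_leI D_le) auto
  also have "\<dots> = ennreal (\<Sum>k. (1/2) ^ k)"
    by (rule suminf_ennreal2) (auto intro!: summable_geometric)
  also have "\<dots> < \<infinity>" by simp
  finally have "AE z in gauss. (\<Sum>k. ennreal (cmod (D k z))) \<noteq> \<infinity>"
    by (intro nn_integral_PInf_AE) auto
  then have conv: "AE z in gauss. convergent (\<lambda>k. S (r k) z)"
  proof eventually_elim
    case (elim z)
    then have "summable (\<lambda>k. cmod (D k z))"
      by (intro summable_suminf_not_top) auto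
    then have "summable (\<lambda>k. D k z)"
      by (rule summable_norm_cancel)
    then have "convergent (\<lambda>n. \<Sum>k<n. D k z)"
      by (simp add: summable_iff_convergent)
    then have "convergent (\<lambda>n. S (r n) z - S (r 0) z)"
      unfolding D_def sum_lessThan_telescope[of "\<lambda>k. S (r k) z"] .
    then show "convergent (\<lambda>k. S (r k) z)"
      using convergent_diff_const_right_iff by blast
  qed
  \<comment> \<open>Off the convergence set \<open>lim\<close> is an unspecified value;
    measurability holds nevertheless, and that set is null.\<close>
  define g where "g z = lim (\<lambda>k. S (r k) z)" for z
  have [measurable]: "g \<in> borel_measurable borel"
    unfolding g_def by measurable
  \<comment> \<open>Fatou along the subsequence with n fixed. The extended nonnegative integral is
    used because the integrability of g is not yet known; it follows from this bound.\<close>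
  have key: "(\<integral>\<^sup>+z. ennreal ((cmod (g z - S n z))\<^sup>2) \<partial>gauss) \<le> ennreal (e\<^sup>2)"
    if "0 < e" and M: "\<And>m n. m \<ge> M \<Longrightarrow> n \<ge> M \<Longrightarrow> L2_norm (\<lambda>z. S m z - S n z) < e" and "n \<ge> M"
    for e M n
  proof -
    have "(\<integral>\<^sup>+z. ennreal ((cmod (g z - S n z))\<^sup>2) \<partial>gauss)
        = (\<integral>\<^sup>+z. liminf (\<lambda>k. ennreal ((cmod (S (r k) z - S n z))\<^sup>2)) \<partial>gauss)"
    proof (rule nn_integral_cong_AE)
      show "AE z in gauss. ennreal ((cmod (g z - S n z))\<^sup>2) = liminf (\<lambda>k. ennreal ((cmod (S (r k) z - S n z))\<^sup>2))"
        using conv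
      proof eventually_elim
        case (elim z)
        then have "(\<lambda>k. S (r k) z) \<longlonglongrightarrow> g z"
          unfolding g_def by (simp add: convergent_LIMSEQ_iff)
        then have "(\<lambda>k. ennreal ((cmod (S (r k) z - S n z))\<^sup>2)) \<longlonglongrightarrow> ennreal ((cmod (g z - S n z))\<^sup>2)"
          by (intro tendsto_ennrealI tendsto_intros)
        then show ?case
          by (intro lim_imp_Liminf[symmetric]) auto
      qed
    qed
    also have "\<dots> \<le> liminf (\<lambda>k. \<integral>\<^sup>+z. ennreal ((cmod (S (r k) z - S n z))\<^sup>2) \<partial>gauss)"
      by (rule nn_integral_liminf) measurable
    also have "\<dots> \<le> liminf (\<lambda>k. ennreal (e\<^sup>2))"
    proof (rule Liminf_mono, rule eventually_sequentiallyI)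
      fix k assume "M \<le> k"
      then have "L2_norm (\<lambda>z. S (r k) z - S n z) \<le> e"
        using M[of "r k" n] r_ge[of k] \<open>n \<ge> M\<close> by simp
      then have "(L2_norm (\<lambda>z. S (r k) z - S n z))\<^sup>2 \<le> e\<^sup>2"
        by (intro power_mono) auto
      moreover have "(\<integral>\<^sup>+z. ennreal ((cmod (S (r k) z - S n z))\<^sup>2) \<partial>gauss)
          = ennreal ((L2_norm (\<lambda>z. S (r k) z - S n z))\<^sup>2)"
        unfolding L2_norm_power2
        by (intro nn_integral_eq_integral L2_integrable L2_diff S) auto
      ultimately show "(\<integral>\<^sup>+z. ennreal ((cmod (S (r k) z - S n z))\<^sup>2) \<partial>gauss) \<le> ennreal (e\<^sup>2)"
        by (simp add: ennreal_leI)
    qed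
    also have "\<dots> = ennreal (e\<^sup>2)"
      by (rule Liminf_const) simp
    finally show ?thesis .
  qed
  have L2_gS: "L2 (\<lambda>z. g z - S n z)" if "n \<ge> M" "0 < e"
    and M: "\<And>m n. m \<ge> M \<Longrightarrow> n \<ge> M \<Longrightarrow> L2_norm (\<lambda>z. S m z - S n z) < e" for n M e
  proof (rule L2I)
    show "integrable gauss (\<lambda>z. (cmod (g z - S n z))\<^sup>2)"
      using le_less_trans[OF key[OF \<open>0 < e\<close> M \<open>n \<ge> M\<close>] ennreal_less_top]
      by (intro integrableI_nonneg) auto
  qed measurable
  have L2g: "L2 g"
  proof -
    have "L2 (\<lambda>z. g z - S (N 0) z)"
      using N[of 0] by (intro L2_gS[of "N 0" _ 1]) auto
    from L2_add[OF this S[of "N 0"]] show ?thesis by simp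
  qed
  moreover have "(\<lambda>n. L2_norm (\<lambda>z. g z - S n z)) \<longlonglongrightarrow> 0"
  proof (rule LIMSEQ_I)
    fix e :: real assume "0 < e"
    then obtain M where M: "\<And>m n. m \<ge> M \<Longrightarrow> n \<ge> M \<Longrightarrow> L2_norm (\<lambda>z. S m z - S n z) < e / 2"
      using Cauchy[of "e / 2"] by auto
    show "\<exists>M. \<forall>n\<ge>M. norm (L2_norm (\<lambda>z. g z - S n z) - 0) < e"
    proof (intro exI allI impI)
      fix n assume "n \<ge> M"
      have "ennreal ((L2_norm (\<lambda>z. g z - S n z))\<^sup>2) \<le> ennreal ((e / 2)\<^sup>2)"
        using key[OF _ M \<open>n \<ge> M\<close>] \<open>0 < e\<close> unfolding L2_norm_power2
        by (subst nn_integral_eq_integral[symmetric]) (auto intro!: L2_integrable L2_diff L2g S)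
      then have "(L2_norm (\<lambda>z. g z - S n z))\<^sup>2 \<le> (e / 2)\<^sup>2"
        by (simp add: ennreal_le_iff)
      then have "L2_norm (\<lambda>z. g z - S n z) \<le> e / 2"
        by (rule power2_le_imp_le) (use \<open>0 < e\<close> in simp)
      then show "norm (L2_norm (\<lambda>z. g z - S n z) - 0) < e"
        using \<open>0 < e\<close> by simp
    qed
  qed
  ultimately show ?thesis by blast
qed

section \<open>Complex Hermite polynomials\<close>

text \<open>Heat flow acts on \<open>hermite s m n\<close> by shifting the variance parameter \<open>s\<close>; \<open>s = 0\<close> gives the
  monomials and \<open>s = -2\<close> the unnormalised \<open>J m n\<close>.  The terms with \<open>r > n\<close> vanish, and the
  truncated subtraction \<open>n - r\<close> does no harm there.\<close>
definition hermite :: "complex \<Rightarrow> nat \<Rightarrow> nat \<Rightarrow> complex \<Rightarrow> complex" where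
  "hermite s m n z = (\<Sum>r\<le>m. s ^ r * fact r * of_nat (m choose r) * of_nat (n choose r)
     * z ^ (m - r) * cnj z ^ (n - r))"

definition J_const :: "nat \<Rightarrow> nat \<Rightarrow> real" where
  "J_const m n = (fact m * fact n * 2 ^ (m + n)) powr (-1/2)"

lemma J_const_pos: "0 < J_const m n"
  by (simp add: J_const_def)

lemma J_const_power2: "(J_const m n)\<^sup>2 = 1 / (fact m * fact n * 2 ^ (m + n))"
proof -
  have "0 < (fact m * fact n * 2 ^ (m + n) :: real)"
    by simp
  then show ?thesis
    unfolding J_const_def
    by (simp add: power2_eq_square powr_add[symmetric] powr_minus_divide del: mult_pos_pos)
qed

lemma J_eq_hermite: "J m n z = J_const m n * hermite (-2) m n z"
proof -
  have "(\<Sum>r = 0..min m n. complex_of_real ((-1) ^ r * fact r * 2 ^ r * real (m choose r) * real (n choose r))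
        * z ^ (m - r) * (cnj z) ^ (n - r)) = hermite (-2) m n z"
    unfolding hermite_def
  proof (rule sum.mono_neutral_cong_left)
    show "\<forall>r\<in>{..m} - {0..min m n}. (-2) ^ r * fact r * of_nat (m choose r) * of_nat (n choose r)
      * z ^ (m - r) * cnj z ^ (n - r) = 0"
      by (auto simp: not_le)
    show "complex_of_real ((-1) ^ r * fact r * 2 ^ r * real (m choose r) * real (n choose r)) * z ^ (m - r) * cnj z ^ (n - r)
      = (-2) ^ r * fact r * of_nat (m choose r) * of_nat (n choose r) * z ^ (m - r) * cnj z ^ (n - r)" for r
      by (simp add: power_minus[of 2])
  qed auto
  then show ?thesis
    by (simp add: J_def J_const_def)
qed

lemma hermite_0: "hermite 0 m n z = z ^ m * cnj z ^ n"
proof -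
  have "hermite 0 m n z = (\<Sum>r\<le>m. if r = 0 then z ^ m * cnj z ^ n else 0)"
    unfolding hermite_def by (intro sum.cong refl) auto
  then show ?thesis by simp
qed

text \<open>Each factor s stands in for one z and one \<open>cnj z\<close>, so the polynomial is
  homogeneous when s carries the weight of \<open>a * cnj a\<close>.\<close>

lemma hermite_scale: "hermite (a * cnj a * s) m n (a * z) = a ^ m * cnj a ^ n * hermite s m n z"
  unfolding hermite_def sum_distrib_left
proof (rule sum.cong[OF refl])
  fix r assume "r \<in> {..m}"
  then have m: "a ^ m = a ^ r * a ^ (m - r)"
    by (simp add: power_add[symmetric])
  show "(a * cnj a * s) ^ r * fact r * of_nat (m choose r) * of_nat (n choose r) * (a * z) ^ (m - r) * cnj (a * z) ^ (n - r)
    = a ^ m * cnj a ^ n * (s ^ r * fact r * of_nat (m choose r) * of_nat (n choose r) * z ^ (m - r) * cnj z ^ (n - r))"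
  proof (cases "r \<le> n")
    case True
    then have n: "cnj a ^ n = cnj a ^ r * cnj a ^ (n - r)"
      by (simp add: power_add[symmetric])
    show ?thesis
      unfolding m n by (simp add: power_mult_distrib mult_ac)
  qed simp
qed

text \<open>This is exp(s D) exp(t D) = exp((s + t) D), D being the mixed derivative in z and its
  conjugate. Grouping by the total order k = r + j leaves the binomial theorem for (s +
  t)^k.\<close>

lemma hermite_add:
  "(\<Sum>r\<le>m. s ^ r * fact r * of_nat (m choose r) * of_nat (n choose r) * hermite t (m - r) (n - r) z)
    = hermite (s + t) m n z"
proof -
  define g :: "nat \<Rightarrow> nat \<Rightarrow> complex" where
    "g r j = s ^ r * fact r * of_nat (m choose r) * of_nat (n choose r) *
      (t ^ j * fact j * of_nat (m - r choose j) * of_nat (n - r choose j) * z ^ (m - r - j) * cnj z ^ (n - r - j))" for r j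
  have "(\<Sum>r\<le>m. s ^ r * fact r * of_nat (m choose r) * of_nat (n choose r) * hermite t (m - r) (n - r) z)
      = (\<Sum>r\<le>m. \<Sum>j\<le>m - r. g r j)"
    unfolding hermite_def sum_distrib_left g_def ..
  also have "\<dots> = (\<Sum>(r, j)\<in>{(r, j). r + j \<le> m}. g r j)"
    by (subst sum.Sigma) (auto intro!: sum.cong)
  also have "\<dots> = (\<Sum>k\<le>m. \<Sum>r\<le>k. g r (k - r))"
    by (rule sum.triangle_reindex_eq)
  also have "\<dots> = hermite (s + t) m n z"
    unfolding hermite_def
  proof (rule sum.cong[OF refl])
    fix k assume "k \<in> {..m}"
    then have k: "k \<le> m" by simp
    have "g r (k - r) = (fact k * of_nat (m choose k) * of_nat (n choose k) * z ^ (m - k) * cnj z ^ (n - k)) *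
        (of_nat (k choose r) * s ^ r * t ^ (k - r))" if "r \<le> k" for r
    proof -
      \<comment> \<open>Both sides count chains of subsets of sizes r and k. The case k > l occurs
        when this is applied to n, and both sides are then zero.\<close>
      have 1: "(l choose r) * (l - r choose (k - r)) = (l choose k) * (k choose r)" for l
      proof (cases "k \<le> l")
        case True
        then show ?thesis using choose_mult[OF \<open>r \<le> k\<close> True] by simp
      next
        case False
        then show ?thesis
          using \<open>r \<le> k\<close> by (cases "r \<le> l") (auto simp: binomial_eq_0)
      qed
      have 2: "fact r * fact (k - r) * (k choose r) = (fact k :: nat)"
        by (rule binomial_fact_lemma[OF \<open>r \<le> k\<close>])
      have "fact r * (m choose r) * (n choose r) * fact (k - r) * (m - r choose (k - r)) * (n - r choose (k - r))
        = (fact r * fact (k - r)) * ((m choose r) * (m - r choose (k - r))) * ((n choose r) * (n - r choose (k - r)))"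
        by (simp only: mult_ac)
      also have "\<dots> = (fact r * fact (k - r) * (k choose r)) * (m choose k) * (n choose k) * (k choose r)"
        unfolding 1 by (simp only: mult_ac)
      finally have "fact r * (m choose r) * (n choose r) * fact (k - r) * (m - r choose (k - r)) * (n - r choose (k - r))
          = fact k * (m choose k) * (n choose k) * (k choose r)"
        unfolding 2 .
      from arg_cong[OF this, of "of_nat :: nat \<Rightarrow> complex"]
      have eq: "fact r * of_nat (m choose r) * of_nat (n choose r) * fact (k - r) * of_nat (m - r choose (k - r)) * of_nat (n - r choose (k - r))
          = (fact k * of_nat (m choose k) * of_nat (n choose k) * of_nat (k choose r) :: complex)"
        by simp
      have sub: "m - r - (k - r) = m - k" "n - r - (k - r) = n - k"
        using that by auto
      have "g r (k - r) = (fact r * of_nat (m choose r) * of_nat (n choose r) * fact (k - r) *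
          of_nat (m - r choose (k - r)) * of_nat (n - r choose (k - r))) *
          (s ^ r * t ^ (k - r) * z ^ (m - k) * cnj z ^ (n - k))"
        unfolding g_def sub by (simp only: mult_ac)
      then show ?thesis
        unfolding eq by (simp only: mult_ac)
    qed
    then have "(\<Sum>r\<le>k. g r (k - r)) = (fact k * of_nat (m choose k) * of_nat (n choose k) * z ^ (m - k) * cnj z ^ (n - k)) * (s + t) ^ k"
      unfolding binomial_ring sum_distrib_left by (intro sum.cong) auto
    then show "(\<Sum>r\<le>k. g r (k - r)) = (s + t) ^ k * fact k * of_nat (m choose k) * of_nat (n choose k) * z ^ (m - k) * cnj z ^ (n - k)"
      by (simp only: mult_ac)
  qed
  finally show ?thesis .
qed

text \<open>In the double binomial expansion only the moments with j = k survive, so it collapses to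
  a single sum of Hermite shape. The parameter \<open>2 * b\<^sup>2\<close> is the mean of the
  squared modulus of b y.\<close>

lemma gauss_shifted_monomial:
  fixes b :: real
  shows "has_bochner_integral gauss (\<lambda>y. (x + b * y) ^ p * cnj (x + b * y) ^ q) (hermite (complex_of_real (2 * b\<^sup>2)) p q x)"
proof -
  let ?c = "\<lambda>j k. of_nat (p choose j) * of_nat (q choose k) * (b ^ j * b ^ k * x ^ (p - j) * cnj x ^ (q - k))"
  have "has_bochner_integral gauss (\<lambda>y. \<Sum>j\<le>p. \<Sum>k\<le>q. ?c j k * (y ^ j * cnj y ^ k))
      (\<Sum>j\<le>p. \<Sum>k\<le>q. ?c j k * (if j = k then 2 ^ j * fact j else 0))"
    by (intro has_bochner_integral_sum has_bochner_integral_mult_right)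
       (simp add: has_bochner_integral_iff integrable_gauss_monomial integral_gauss_monomial)
  moreover have "(\<Sum>j\<le>p. \<Sum>k\<le>q. ?c j k * (y ^ j * cnj y ^ k)) = (x + b * y) ^ p * cnj (x + b * y) ^ q" for y :: complex
  proof -
    have "(x + b * y) ^ p * cnj (x + b * y) ^ q = (b * y + x) ^ p * (b * cnj y + cnj x) ^ q"
      by (simp add: add.commute)
    then show ?thesis
      unfolding binomial_ring sum_product by (simp add: power_mult_distrib mult_ac)
  qed
  moreover have "(\<Sum>j\<le>p. \<Sum>k\<le>q. ?c j k * (if j = k then 2 ^ j * fact j else 0)) = hermite (complex_of_real (2 * b\<^sup>2)) p q x"
    unfolding hermite_def
  proof (rule sum.cong[OF refl])
    fix j
    have "(\<Sum>k\<le>q. ?c j k * (if j = k then 2 ^ j * fact j else 0)) = (if j \<le> q then ?c j j * (2 ^ j * fact j) else 0)"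
      by (simp add: if_distrib[where f="\<lambda>x. _ * x"] cong: if_cong)
    also have "\<dots> = complex_of_real (2 * b\<^sup>2) ^ j * fact j * of_nat (p choose j) * of_nat (q choose j) * x ^ (p - j) * cnj x ^ (q - j)"
      by (simp add: power_mult_distrib power2_eq_square mult_ac)
    finally show "(\<Sum>k\<le>q. ?c j k * (if j = k then 2 ^ j * fact j else 0)) =
       complex_of_real (2 * b\<^sup>2) ^ j * fact j * of_nat (p choose j) * of_nat (q choose j) * x ^ (p - j) * cnj x ^ (q - j)" .
  qed
  ultimately show ?thesis by simp
qed

lemma gauss_shifted_hermite:
  fixes b :: real and s :: complex
  shows "has_bochner_integral gauss (\<lambda>y. hermite s m n (x + b * y)) (hermite (s + complex_of_real (2 * b\<^sup>2)) m n x)"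
proof -
  have "has_bochner_integral gauss (\<lambda>y. \<Sum>r\<le>m. s ^ r * fact r * of_nat (m choose r) * of_nat (n choose r) *
        ((x + b * y) ^ (m - r) * cnj (x + b * y) ^ (n - r)))
      (\<Sum>r\<le>m. s ^ r * fact r * of_nat (m choose r) * of_nat (n choose r) * hermite (complex_of_real (2 * b\<^sup>2)) (m - r) (n - r) x)"
    by (intro has_bochner_integral_sum has_bochner_integral_mult_right gauss_shifted_monomial)
  then show ?thesis
    unfolding hermite_add by (simp only: hermite_def mult.assoc)
qed

text \<open>Averaging moves the parameter from -2 to \<open>-2 + 2 * b\<^sup>2\<close>, which the
  hypothesis turns into -2 times the squared modulus of a. Pulling a out of the argument then
  restores -2 and leaves the eigenvalue.\<close>

lemma J_Mehler:
  fixes b :: real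
  assumes "a * cnj a + b\<^sup>2 = 1"
  shows "has_bochner_integral gauss (\<lambda>y. J m n (a * x + b * y)) (a ^ m * cnj a ^ n * J m n x)"
proof -
  have b: "complex_of_real (b\<^sup>2) = 1 - a * cnj a"
    using assms by (metis add_diff_cancel_left')
  have "-2 + complex_of_real (2 * b\<^sup>2) = a * cnj a * (-2)"
    unfolding of_real_mult b by simp
  then have "has_bochner_integral gauss (\<lambda>y. hermite (-2) m n (a * x + b * y)) (a ^ m * cnj a ^ n * hermite (-2) m n x)"
    using gauss_shifted_hermite[of "-2" m n "a * x" b] hermite_scale[of a "-2" m n x] by simp
  from has_bochner_integral_mult_right[OF this, of "J_const m n"] show ?thesis
    unfolding J_eq_hermite by (simp add: mult_ac)
qed

lemma L2_monomial: "L2 (\<lambda>z. z ^ p * cnj z ^ q)"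
proof (rule L2I)
  have "(cmod (z ^ p * cnj z ^ q))\<^sup>2 = norm (z ^ (p + q) * cnj z ^ (p + q))" for z
    by (simp add: norm_mult norm_power power_add power2_eq_square mult_ac)
  then show "integrable gauss (\<lambda>z. (cmod (z ^ p * cnj z ^ q))\<^sup>2)"
    using integrable_norm[OF integrable_gauss_monomial[of "p + q" "p + q"]] by simp
qed measurable

lemma L2_hermite: "L2 (hermite s m n)"
  unfolding hermite_def[abs_def] mult.assoc by (intro L2_sum L2_cmult L2_monomial)

lemma L2_J: "L2 (J m n)"
  unfolding J_eq_hermite[abs_def] by (intro L2_cmult L2_hermite)

lemma continuous_J: "continuous_on UNIV (J m n)"
  unfolding J_def[abs_def] by (intro continuous_intros)

text \<open>An m-fold backward difference of the function taking N to \<open>N choose p\<close>: by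
  Pascal's rule every difference lowers N and p by one, and it annihilates the function once p is
  exhausted.\<close>

lemma alternating_binomial_sum:
  "m \<le> N \<Longrightarrow> (\<Sum>r\<le>m. (-1) ^ r * of_nat (m choose r) * of_nat (N - r choose p))
    = (if p < m then 0 else of_nat (N - m choose (p - m)) :: complex)"
proof (induction m arbitrary: N p)
  case 0
  then show ?case by simp
next
  case (Suc m)
  let ?f = "\<lambda>r. of_nat (N - r choose p) :: complex"
  have "(\<Sum>r\<le>Suc m. (-1) ^ r * of_nat (Suc m choose r) * ?f r)
      = ?f 0 + (\<Sum>r\<le>m. (-1) ^ Suc r * of_nat (Suc m choose Suc r) * ?f (Suc r))"
    by (subst sum.atMost_Suc_shift) simp
  also have "\<dots> = ?f 0 + (\<Sum>r\<le>m. (-1) ^ Suc r * of_nat (m choose Suc r) * ?f (Suc r))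
      - (\<Sum>r\<le>m. (-1) ^ r * of_nat (m choose r) * ?f (Suc r))"
    by (simp add: sum.distrib sum_negf algebra_simps sum_subtractf)
  also have "?f 0 + (\<Sum>r\<le>m. (-1) ^ Suc r * of_nat (m choose Suc r) * ?f (Suc r))
      = (\<Sum>r\<le>Suc m. (-1) ^ r * of_nat (m choose r) * ?f r)"
    by (subst sum.atMost_Suc_shift) simp
  also have "\<dots> = (\<Sum>r\<le>m. (-1) ^ r * of_nat (m choose r) * ?f r)"
    by simp
  also have "(\<Sum>r\<le>m. (-1) ^ r * of_nat (m choose r) * ?f r) - (\<Sum>r\<le>m. (-1) ^ r * of_nat (m choose r) * ?f (Suc r))
      = (\<Sum>r\<le>m. (-1) ^ r * of_nat (m choose r) * (?f r - ?f (Suc r)))"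
    by (simp add: sum_subtractf algebra_simps)
  also have "\<dots> = (\<Sum>r\<le>m. (-1) ^ r * of_nat (m choose r) * (if p = 0 then 0 else of_nat (N - 1 - r choose (p - 1))))"
  proof (rule sum.cong[OF refl])
    fix r assume "r \<in> {..m}"
    then have "N - r = Suc (N - 1 - r)" "N - Suc r = N - 1 - r"
      using Suc.prems by auto
    \<comment> \<open>The case p = 0 is separate because \<open>p - 1\<close> would truncate to 0
      and give 1 in place of the true difference 0.\<close>
    moreover have "of_nat (Suc k choose p) - of_nat (k choose p) =
        (if p = 0 then 0 else of_nat (k choose (p - 1)) :: complex)" for k
      by (cases p) simp_all
    ultimately have "?f r - ?f (Suc r) = (if p = 0 then 0 else of_nat (N - 1 - r choose (p - 1)))"
      by (simp only:)
    then show "(-1) ^ r * of_nat (m choose r) * (?f r - ?f (Suc r)) =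
       (-1) ^ r * of_nat (m choose r) * (if p = 0 then 0 else of_nat (N - 1 - r choose (p - 1)))"
      by simp
  qed
  also have "\<dots> = (if p < Suc m then 0 else of_nat (N - Suc m choose (p - Suc m)))"
    using Suc.IH[of "N - 1" "p - 1"] Suc.prems by (cases p) auto
  finally show ?case .
qed

text \<open>Rotational symmetry forces m + q = n + p. The Gaussian moments then turn the signed sum
  into the m-th difference of a binomial coefficient, which is what makes it vanish for p <
  m.\<close>

lemma L2_inner_hermite_monomial:
  "L2_inner (hermite (-2) m n) (\<lambda>z. z ^ p * cnj z ^ q) =
     (if m + q = n + p then 2 ^ (m + q) * fact n * fact p *
        (if p < m then 0 else of_nat (m + q - m choose (p - m))) else 0)"
proof -
  have "L2_inner (hermite (-2) m n) (\<lambda>z. z ^ p * cnj z ^ q) =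
    (\<Sum>r\<le>m. L2_inner (\<lambda>z. (-2) ^ r * fact r * of_nat (m choose r) * of_nat (n choose r) *
       (z ^ (m - r) * cnj z ^ (n - r))) (\<lambda>z. z ^ p * cnj z ^ q))"
    unfolding hermite_def[abs_def] mult.assoc
    by (subst L2_inner_sum_left) (auto intro!: L2_cmult L2_monomial)
  also have "\<dots> = (\<Sum>r\<le>m. (-2) ^ r * fact r * of_nat (m choose r) * of_nat (n choose r) *
       (LINT z|gauss. z ^ (m - r + q) * cnj z ^ (n - r + p)))"
    unfolding L2_inner_cmult_left
    by (simp only: L2_inner_def complex_cnj_mult complex_cnj_power complex_cnj_cnj power_add mult_ac)
  also have "\<dots> = (\<Sum>r\<le>m. if m + q = n + p then 2 ^ (m + q) * fact n * fact p *
      ((-1) ^ r * of_nat (m choose r) * of_nat (m + q - r choose p)) else 0)"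
  proof (rule sum.cong[OF refl])
    fix r assume "r \<in> {..m}"
    then have r: "r \<le> m" by simp
    show "(-2) ^ r * fact r * of_nat (m choose r) * of_nat (n choose r) *
       (LINT z|gauss. z ^ (m - r + q) * cnj z ^ (n - r + p)) = (if m + q = n + p then 2 ^ (m + q) * fact n * fact p *
      ((-1) ^ r * of_nat (m choose r) * of_nat (m + q - r choose p)) else 0)"
    proof (cases "r \<le> n")
      case False
      then show ?thesis by (auto simp: binomial_eq_0)
    next
      case True
      then have eq: "m - r + q = n - r + p \<longleftrightarrow> m + q = n + p"
        using r by auto
      show ?thesis
      proof (cases "m + q = n + p")
        case False
        then show ?thesis by (simp add: integral_gauss_monomial eq)
      next
        case K: True
        have mq: "m - r + q = n - r + p" and mqr: "m + q - r = n - r + p"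
          using eq K True r by auto
        have p2: "(2::complex) ^ (m + q) = 2 ^ r * 2 ^ (n - r + p)"
        proof -
          have "m + q = r + (n - r + p)" using r mq by simp
          then show ?thesis by (simp only: power_add)
        qed
        \<comment> \<open>Isolates the dependence on r in one binomial coefficient, the shape that
          \<open>alternating_binomial_sum\<close> expects.\<close>
        have f: "fact r * of_nat (n choose r) * fact (n - r + p) =
            (fact n * fact p * of_nat (n - r + p choose p) :: complex)"
          unfolding binomial_fact[OF True, where 'a=complex] binomial_fact[OF le_add2, where 'a=complex]
          by simp
        have "(-2) ^ r * fact r * of_nat (m choose r) * of_nat (n choose r) * (2 ^ (n - r + p) * fact (n - r + p))
            = (-1) ^ r * 2 ^ r * of_nat (m choose r) * 2 ^ (n - r + p) *
              (fact r * of_nat (n choose r) * fact (n - r + p) :: complex)"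
          unfolding power_minus[of 2] by (simp only: mult_ac)
        also have "\<dots> = 2 ^ r * 2 ^ (n - r + p) * fact n * fact p *
            ((-1) ^ r * of_nat (m choose r) * of_nat (n - r + p choose p))"
          unfolding f by (simp only: mult_ac)
        finally show ?thesis
          using K unfolding integral_gauss_monomial mq mqr p2 by (simp only: simp_thms if_True)
      qed
    qed
  qed
  also have "\<dots> = (if m + q = n + p then 2 ^ (m + q) * fact n * fact p *
        (if p < m then 0 else of_nat (m + q - m choose (p - m))) else 0)"
    using alternating_binomial_sum[of m "m + q" p]
    by (cases "m + q = n + p") (simp_all only: simp_thms if_True if_False sum_distrib_left[symmetric] le_add1 sum.neutral_const)
  finally show ?thesis .
qed

text \<open>The formula tests only p < m, but under the balance m + q = n + p the condition q < n
  implies it.\<close>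

lemma L2_inner_hermite_lower:
  assumes "p < m \<or> q < n"
  shows "L2_inner (hermite (-2) m n) (\<lambda>z. z ^ p * cnj z ^ q) = 0"
  using assms by (auto simp: L2_inner_hermite_monomial)

lemma L2_inner_hermite_diag:
  "L2_inner (hermite (-2) m n) (\<lambda>z. z ^ m * cnj z ^ n) = 2 ^ (m + n) * fact m * fact n"
  by (simp add: L2_inner_hermite_monomial add.commute mult_ac)

lemma L2_inner_hermite_hermite_sum:
  "L2_inner (hermite (-2) m n) (hermite (-2) p q) =
    (\<Sum>r\<le>p. (-2) ^ r * fact r * of_nat (p choose r) * of_nat (q choose r) *
      L2_inner (hermite (-2) m n) (\<lambda>z. z ^ (p - r) * cnj z ^ (q - r)))"
proof -
  have "L2_inner (hermite (-2) p q) (hermite (-2) m n) =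
     (\<Sum>r\<le>p. L2_inner (\<lambda>z. (-2) ^ r * fact r * of_nat (p choose r) * of_nat (q choose r) *
       (z ^ (p - r) * cnj z ^ (q - r))) (hermite (-2) m n))"
    unfolding hermite_def[of _ p q, abs_def] mult.assoc
    by (subst L2_inner_sum_left) (auto intro!: L2_cmult L2_monomial L2_hermite)
  then show ?thesis
    unfolding L2_inner_commute[of "hermite (-2) m n" "hermite (-2) p q"] L2_inner_cmult_left
      L2_inner_commute[of "hermite (-2) m n" "\<lambda>z. z ^ _ * cnj z ^ _"]
    by simp
qed

text \<open>If p < m or q < n, every monomial of the second polynomial is orthogonal to the first.
  Distinct index pairs satisfy this in one order or the other, and conjugate symmetry exchanges the
  two.\<close>

lemma L2_inner_hermite:
  "L2_inner (hermite (-2) m n) (hermite (-2) p q) =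
    (if m = p \<and> n = q then 2 ^ (m + n) * fact m * fact n else 0)"
proof -
  have lower: "L2_inner (hermite (-2) m n) (hermite (-2) p q) = 0" if "p < m \<or> q < n" for m n p q
    unfolding L2_inner_hermite_hermite_sum
  proof (intro sum.neutral ballI)
    fix r
    have "p - r < m \<or> q - r < n" using that by auto
    then show "(-2) ^ r * fact r * of_nat (p choose r) * of_nat (q choose r) *
        L2_inner (hermite (-2) m n) (\<lambda>z. z ^ (p - r) * cnj z ^ (q - r)) = 0"
      by (simp add: L2_inner_hermite_lower)
  qed
  have diag: "L2_inner (hermite (-2) m n) (hermite (-2) m n) = 2 ^ (m + n) * fact m * fact n"
  proof -
    have "L2_inner (hermite (-2) m n) (hermite (-2) m n) =
        (\<Sum>r\<le>m. if r = 0 then 2 ^ (m + n) * fact m * fact n else 0)"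
      unfolding L2_inner_hermite_hermite_sum
    proof (rule sum.cong[OF refl])
      fix r
      \<comment> \<open>For r > 0 either the exponent m - r is below m, so orthogonality applies, or
        m = 0 and the binomial coefficient is zero.\<close>
      show "(-2) ^ r * fact r * of_nat (m choose r) * of_nat (n choose r) *
        L2_inner (hermite (-2) m n) (\<lambda>z. z ^ (m - r) * cnj z ^ (n - r)) =
        (if r = 0 then 2 ^ (m + n) * fact m * fact n else 0)"
        using L2_inner_hermite_diag[of m n]
        by (cases "r = 0"; cases "m = 0") (auto simp: L2_inner_hermite_lower binomial_eq_0)
    qed
    then show ?thesis by simp
  qed
  consider "m = p \<and> n = q" | "p < m \<or> q < n" | "m < p \<or> n < q" by linarith
  then show ?thesis
  proof cases
    case 3
    then show ?thesis
      using lower[of m p n q] L2_inner_commute[of "hermite (-2) m n" "hermite (-2) p q"] by auto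
  qed (use diag lower in auto)
qed

lemma J_orthonormal: "L2_inner (J m n) (J p q) = (if m = p \<and> n = q then 1 else 0)"
proof -
  have "L2_inner (J m n) (J p q) = J_const m n * cnj (J_const p q) * L2_inner (hermite (-2) m n) (hermite (-2) p q)"
    unfolding J_eq_hermite[abs_def] L2_inner_cmult_left
    by (subst L2_inner_commute, subst L2_inner_cmult_left) (simp add: L2_inner_commute[symmetric])
  also have "\<dots> = (if m = p \<and> n = q then complex_of_real ((J_const m n)\<^sup>2) * (2 ^ (m + n) * fact m * fact n) else 0)"
    by (simp add: L2_inner_hermite power2_eq_square)
  also have "\<dots> = (if m = p \<and> n = q then 1 else 0)"
    unfolding J_const_power2 by simp
  finally show ?thesis .
qed

section \<open>Completeness of the Hermite system\<close>

lemma norm_exp_partial_sum_le: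
  fixes z :: complex
  shows "norm (\<Sum>k<n. z ^ k / fact k) \<le> exp (norm z)"
proof -
  have "norm (\<Sum>k<n. z ^ k / fact k) \<le> (\<Sum>k<n. norm z ^ k /\<^sub>R fact k)"
    by (rule order.trans[OF norm_sum], rule sum_mono) (simp add: norm_divide norm_power field_simps)
  also have "\<dots> \<le> (\<Sum>k. norm z ^ k /\<^sub>R fact k)"
    by (intro sum_le_suminf summable_exp_generic) auto
  finally show ?thesis by (simp add: exp_def)
qed

lemma power_le_fact_exp:
  fixes x :: real
  assumes "0 \<le> x"
  shows "x ^ k \<le> fact k * exp x"
proof -
  have "(\<Sum>i\<in>{k}. x ^ i /\<^sub>R fact i) \<le> (\<Sum>i. x ^ i /\<^sub>R fact i)"
    using assms by (intro sum_le_suminf summable_exp_generic) auto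
  then show ?thesis by (simp add: exp_def field_simps)
qed

text \<open>Exponential integrability turns vanishing moments into a vanishing Fourier transform; Levy's
  uniqueness theorem is then applied to the normalised positive and negative parts of \<open>h\<close>.\<close>
lemma integral_indicator_eq_0_of_moments:
  fixes h X :: "'a \<Rightarrow> real"
  assumes [measurable]: "h \<in> borel_measurable M" "X \<in> borel_measurable M"
    and int: "\<And>c. 0 \<le> c \<Longrightarrow> integrable M (\<lambda>w. h w * exp (c * \<bar>X w\<bar>))"
    and moments: "\<And>k. (LINT w|M. h w * X w ^ k) = 0"
    and A [measurable]: "A \<in> sets borel"
  shows "(LINT w|M. h w * indicator A (X w)) = 0"
proof -
  have int_h: "integrable M h"
    using int[of 0] by simp
  have int_pow: "integrable M (\<lambda>w. h w * X w ^ k)" for k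
  proof (rule Bochner_Integration.integrable_bound)
    show "integrable M (\<lambda>w. fact k * (h w * exp (1 * \<bar>X w\<bar>)))"
      by (intro integrable_mult_right int) simp
    show "AE w in M. norm (h w * X w ^ k) \<le> norm (fact k * (h w * exp (1 * \<bar>X w\<bar>)))"
    proof (rule AE_I2)
      fix w
      have "\<bar>h w\<bar> * \<bar>X w\<bar> ^ k \<le> \<bar>h w\<bar> * (fact k * exp \<bar>X w\<bar>)"
        by (intro mult_left_mono power_le_fact_exp) auto
      then show "norm (h w * X w ^ k) \<le> norm (fact k * (h w * exp (1 * \<bar>X w\<bar>)))"
        by (simp add: abs_mult power_abs mult_ac)
    qed
  qed measurable
  \<comment> \<open>Partial sums of the exponential series integrate to combinations of moments,
    hence to zero; all of them are dominated by the exponential of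
    \<open>\<bar>u\<bar> * \<bar>X w\<bar>\<close>, which is integrable against h.\<close>
  have fourier: "(LINT w|M. complex_of_real (h w) * iexp (u * X w)) = 0" for u
  proof -
    define s where "s n w = complex_of_real (h w) * (\<Sum>k<n. (\<i> * complex_of_real (u * X w)) ^ k / fact k)" for n w
    have [measurable]: "s n \<in> borel_measurable M" for n
      unfolding s_def by measurable
    have "(\<lambda>n. LINT w|M. s n w) \<longlonglongrightarrow> (LINT w|M. complex_of_real (h w) * iexp (u * X w))"
    proof (rule integral_dominated_convergence)
      show "integrable M (\<lambda>w. \<bar>h w * exp (\<bar>u\<bar> * \<bar>X w\<bar>)\<bar>)"
        by (intro integrable_abs int) simp
      have "(\<lambda>n. \<Sum>k<n. z ^ k / fact k) \<longlonglongrightarrow> exp z" for z :: complex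
        using exp_converges[of z] by (simp add: sums_def scaleR_conv_of_real field_simps)
      then show "AE w in M. (\<lambda>n. s n w) \<longlonglongrightarrow> complex_of_real (h w) * iexp (u * X w)"
        unfolding s_def by (intro AE_I2 tendsto_intros)
      show "AE w in M. norm (s n w) \<le> \<bar>h w * exp (\<bar>u\<bar> * \<bar>X w\<bar>)\<bar>" for n
        using norm_exp_partial_sum_le[of "\<i> * complex_of_real (u * X w)" n for w]
        by (auto simp: s_def norm_mult abs_mult intro!: AE_I2 mult_left_mono)
    qed measurable
    moreover have "(LINT w|M. s n w) = 0" for n
    proof -
      have "(LINT w|M. s n w) = (LINT w|M. (\<Sum>k<n. (\<i> * u) ^ k / fact k * complex_of_real (h w * X w ^ k)))"
        by (simp add: s_def sum_distrib_left power_mult_distrib mult_ac)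
      also have "\<dots> = (\<Sum>k<n. (\<i> * u) ^ k / fact k * complex_of_real (LINT w|M. h w * X w ^ k))"
        by (subst Bochner_Integration.integral_sum)
           (auto intro!: integrable_mult_right integrable_of_real int_pow sum.cong simp del: of_real_mult)
      finally show ?thesis by (simp add: moments)
    qed
    ultimately show ?thesis
      by (simp add: LIMSEQ_const_iff)
  qed
  define hp where "hp w = max 0 (h w)" for w
  define hm where "hm w = max 0 (- h w)" for w
  have [measurable]: "hp \<in> borel_measurable M" "hm \<in> borel_measurable M"
    unfolding hp_def hm_def by measurable
  have h_eq: "h w = hp w - hm w" for w
    by (simp add: hp_def hm_def)
  have int_pm: "integrable M hp" "integrable M hm"
    unfolding hp_def hm_def using int_h by (auto intro!: integrable_max)
  have nonneg: "0 \<le> hp w" "0 \<le> hm w" for w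
    by (simp_all add: hp_def hm_def)
  define c where "c = (LINT w|M. hp w)"
  \<comment> \<open>The moment of order zero: the two parts have equal mass, so one constant
    normalises both.\<close>
  have c_hm: "(LINT w|M. hm w) = c"
    using moments[of 0] int_pm by (simp add: h_eq c_def)
  show ?thesis
  proof (cases "c = 0")
    \<comment> \<open>Without mass there is nothing to normalise, but then both parts vanish almost
      everywhere.\<close>
    case True
    have "AE w in M. hp w = 0" "AE w in M. hm w = 0"
      using integral_nonneg_eq_0_iff_AE[of M hp] integral_nonneg_eq_0_iff_AE[of M hm] int_pm nonneg c_hm True
      by (auto simp: c_def)
    then have "AE w in M. h w * indicator A (X w) = 0"
      by eventually_elim (simp add: h_eq)
    then show ?thesis
      by (rule integral_eq_zero_AE)
  next
    case False
    moreover have "0 \<le> c" using nonneg by (simp add: c_def)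
    ultimately have c: "0 < c" by simp
    define D where "D g = distr (density M (\<lambda>w. ennreal (g w / c))) borel X" for g
    have D_integral: "(LINT x|D g. F x) = (LINT w|M. (g w / c) *\<^sub>R F (X w))"
      if [measurable]: "g \<in> borel_measurable M" "F \<in> borel_measurable borel" and "\<And>w. 0 \<le> g w"
      for g and F :: "real \<Rightarrow> complex"
      unfolding D_def using that(3) c
      by (subst integral_distr) (auto simp: integral_density intro!: integral_density)
    have D_distr: "real_distribution (D g)"
      if [measurable]: "g \<in> borel_measurable M" and "integrable M g" "\<And>w. 0 \<le> g w" "(LINT w|M. g w) = c" for g
    proof -
      have "(\<integral>\<^sup>+w. ennreal (g w / c) \<partial>M) = ennreal (LINT w|M. g w / c)"
        using that c by (intro nn_integral_eq_integral) auto
      also have "\<dots> = 1"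
        using that c by simp
      finally have "prob_space (density M (\<lambda>w. ennreal (g w / c)))"
        by (intro prob_spaceI) (simp add: emeasure_density cong: nn_integral_cong)
      then have "prob_space (D g)"
        unfolding D_def by (rule prob_space.prob_space_distr) simp
      then show ?thesis
        by (intro real_distribution.intro real_distribution_axioms.intro) (simp_all add: D_def)
    qed
    have bnd: "integrable M (\<lambda>w. (g w / c) *\<^sub>R F (X w))"
      if [measurable]: "integrable M g" "F \<in> borel_measurable borel" and "\<And>x. norm (F x) \<le> 1" for g and F :: "real \<Rightarrow> complex"
    proof (rule Bochner_Integration.integrable_bound)
      show "integrable M (\<lambda>w. g w / c)"
        using that by simp
      show "AE w in M. norm ((g w / c) *\<^sub>R F (X w)) \<le> norm (g w / c)"
        using that(3) by (auto intro!: AE_I2 divide_right_mono mult_left_le)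
    qed measurable
    \<comment> \<open>Used twice: with F a character, to see that the two laws have the same
      characteristic function, and with F the indicator of A, to read off the conclusion.\<close>
    have diff: "(LINT x|D hp. F x) - (LINT x|D hm. F x) = (LINT w|M. complex_of_real (h w) * F (X w)) / c"
      if [measurable]: "F \<in> borel_measurable borel" and F1: "\<And>x. norm (F x) \<le> 1" for F :: "real \<Rightarrow> complex"
    proof -
      have "(LINT x|D hp. F x) - (LINT x|D hm. F x) = (LINT w|M. (hp w / c) *\<^sub>R F (X w) - (hm w / c) *\<^sub>R F (X w))"
        by (subst Bochner_Integration.integral_diff) (auto simp: D_integral nonneg intro!: bnd int_pm F1)
      also have "\<dots> = (LINT w|M. complex_of_real (h w) * F (X w) / c)"
        by (intro Bochner_Integration.integral_cong refl) (simp add: h_eq scaleR_conv_of_real left_diff_distrib diff_divide_distrib)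
      finally show ?thesis by simp
    qed
    have "D hp = D hm"
    proof (rule Levy_uniqueness)
      show "real_distribution (D hp)" "real_distribution (D hm)"
        using int_pm nonneg c_hm by (auto intro!: D_distr simp: c_def)
      show "char (D hp) = char (D hm)"
      proof
        fix u
        show "char (D hp) u = char (D hm) u"
          using diff[of "\<lambda>x. iexp (u * x)"] fourier[of u] by (simp add: char_def)
      qed
    qed
    then have "(LINT w|M. complex_of_real (h w) * complex_of_real (indicator A (X w))) = 0"
      using diff[of "\<lambda>x. complex_of_real (indicator A x)"] c by (simp add: indicator_def)
    then have "(LINT w|M. complex_of_real (h w * indicator A (X w))) = 0"
      by simp
    then show ?thesis
      unfolding integral_complex_of_real of_real_eq_0_iff .
  qed
qed


lemma integral_gauss_eq_0_imp_AE_0_real: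
  fixes h :: "complex \<Rightarrow> real"
  assumes L2h: "L2 (\<lambda>z. complex_of_real (h z))"
    and moments: "\<And>i j. (LINT z|gauss. h z * (Re z ^ i * Im z ^ j)) = 0"
  shows "AE z in gauss. h z = 0"
proof -
  have h [measurable]: "h \<in> borel_measurable borel"
    using measurable_compose[OF L2_measurable[OF L2h] borel_measurable_Re] by simp
  have int_mult: "integrable gauss (\<lambda>z. h z * g z)"
    if "L2 (\<lambda>z. complex_of_real (g z))" for g :: "complex \<Rightarrow> real"
    using L2_integrable_mult(1)[OF L2h that] unfolding of_real_mult[symmetric] complex_of_real_integrable_eq .
  have int_h: "integrable gauss h"
    using int_mult[of "\<lambda>_. 1"] L2_const[of 1] by simp
  \<comment> \<open>Since h is only square-integrable, the exponentials must be so too for the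
    product to be integrable; squaring merely doubles the rates.\<close>
  have L2_exp: "L2 (\<lambda>z. complex_of_real (exp (c * \<bar>Re z\<bar>) * exp (d * \<bar>Im z\<bar>)))" if "0 \<le> c" "0 \<le> d" for c d
  proof (rule L2I)
    have "integrable gauss (\<lambda>z. exp (2 * c * \<bar>Re z\<bar>) * exp (2 * d * \<bar>Im z\<bar>))"
      using that by (intro integrable_gauss_exp_abs) auto
    moreover have "(cmod (complex_of_real (exp (c * \<bar>Re z\<bar>) * exp (d * \<bar>Im z\<bar>))))\<^sup>2 =
        exp (2 * c * \<bar>Re z\<bar>) * exp (2 * d * \<bar>Im z\<bar>)" for z
      unfolding norm_of_real power2_abs power2_eq_square by (simp add: exp_add[symmetric])
    ultimately show "integrable gauss (\<lambda>z. (cmod (complex_of_real (exp (c * \<bar>Re z\<bar>) * exp (d * \<bar>Im z\<bar>))))\<^sup>2)"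
      by simp
  qed measurable
  \<comment> \<open>The power of \<open>Im z\<close> is carried along as part of the density, so
    that moments in the second coordinate survive the replacement of powers of \<open>Re z\<close>
    by an indicator.\<close>
  have half: "(LINT z|gauss. (h z * Im z ^ j) * indicator A (Re z)) = 0" if A: "A \<in> sets borel" for A j
  proof (rule integral_indicator_eq_0_of_moments[OF _ _ _ _ A])
    show "integrable gauss (\<lambda>z. (h z * Im z ^ j) * exp (c * \<bar>Re z\<bar>))" if "0 \<le> c" for c
    proof (rule Bochner_Integration.integrable_bound)
      show "integrable gauss (\<lambda>z. fact j * (h z * (exp (c * \<bar>Re z\<bar>) * exp (1 * \<bar>Im z\<bar>))))"
        using that by (intro integrable_mult_right int_mult L2_exp) auto
      show "AE z in gauss. norm ((h z * Im z ^ j) * exp (c * \<bar>Re z\<bar>)) \<le>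
          norm (fact j * (h z * (exp (c * \<bar>Re z\<bar>) * exp (1 * \<bar>Im z\<bar>))))"
      proof (rule AE_I2)
        fix z
        have "(\<bar>h z\<bar> * exp (c * \<bar>Re z\<bar>)) * \<bar>Im z\<bar> ^ j \<le> (\<bar>h z\<bar> * exp (c * \<bar>Re z\<bar>)) * (fact j * exp \<bar>Im z\<bar>)"
          by (intro mult_left_mono power_le_fact_exp) auto
        then show "norm ((h z * Im z ^ j) * exp (c * \<bar>Re z\<bar>)) \<le>
          norm (fact j * (h z * (exp (c * \<bar>Re z\<bar>) * exp (1 * \<bar>Im z\<bar>))))"
          by (simp add: abs_mult power_abs mult_ac)
      qed
    qed measurable
    show "(LINT z|gauss. (h z * Im z ^ j) * Re z ^ k) = 0" for k
      using moments[of k j] by (simp add: mult_ac)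
  qed measurable
  \<comment> \<open>Now the indicator in \<open>Re z\<close> belongs to the density, and its moments
    in \<open>Im z\<close> vanish by \<open>half\<close>.\<close>
  have rect: "(LINT z|gauss. (h z * indicator A (Re z)) * indicator B (Im z)) = 0"
    if A [measurable]: "A \<in> sets borel" and B: "B \<in> sets borel" for A B
  proof (rule integral_indicator_eq_0_of_moments[OF _ _ _ _ B])
    show "integrable gauss (\<lambda>z. (h z * indicator A (Re z)) * exp (c * \<bar>Im z\<bar>))" if "0 \<le> c" for c
    proof (rule Bochner_Integration.integrable_bound)
      show "integrable gauss (\<lambda>z. h z * (exp (0 * \<bar>Re z\<bar>) * exp (c * \<bar>Im z\<bar>)))"
        using that by (intro int_mult L2_exp) auto
    qed (measurable, auto simp: indicator_def)
    show "(LINT z|gauss. (h z * indicator A (Re z)) * Im z ^ k) = 0" for k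
      using half[OF A, of k] by (simp add: mult_ac)
  qed measurable
  define hp where "hp z = max 0 (h z)" for z
  define hm where "hm z = max 0 (- h z)" for z
  have [measurable]: "hp \<in> borel_measurable borel" "hm \<in> borel_measurable borel"
    unfolding hp_def hm_def by measurable
  have h_eq: "h z = hp z - hm z" for z
    by (simp add: hp_def hm_def)
  have int_pm: "integrable gauss hp" "integrable gauss hm"
    unfolding hp_def hm_def using int_h by (auto intro!: integrable_max)
  have nonneg: "0 \<le> hp z" "0 \<le> hm z" for z
    by (simp_all add: hp_def hm_def)
  have emeasure_box: "emeasure (density gauss (\<lambda>z. ennreal (g z))) (box l u) = ennreal (LINT z|gauss. g z * indicator (box l u) z)"
    if [measurable]: "integrable gauss g" "g \<in> borel_measurable borel" and "\<And>z. 0 \<le> g z" for g l u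
  proof -
    have "emeasure (density gauss (\<lambda>z. ennreal (g z))) (box l u) = (\<integral>\<^sup>+z. ennreal (g z * indicator (box l u) z) \<partial>gauss)"
      by (subst emeasure_density) (auto intro!: nn_integral_cong simp: indicator_def)
    also have "\<dots> = ennreal (LINT z|gauss. g z * indicator (box l u) z)"
      using that by (intro nn_integral_eq_integral integrable_real_mult_indicator) auto
    finally show ?thesis .
  qed
  have eq_box: "emeasure (density gauss (\<lambda>z. ennreal (hp z))) (box l u) = emeasure (density gauss (\<lambda>z. ennreal (hm z))) (box l u)" for l u
  proof -
    have "(LINT z|gauss. hp z * indicator (box l u) z) - (LINT z|gauss. hm z * indicator (box l u) z)
        = (LINT z|gauss. h z * indicator (box l u) z)"
      using int_pm
      by (subst Bochner_Integration.integral_diff[symmetric])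
         (auto simp: h_eq left_diff_distrib intro!: integrable_real_mult_indicator)
    also have "\<dots> = (LINT z|gauss. (h z * indicator {Re l<..<Re u} (Re z)) * indicator {Im l<..<Im u} (Im z))"
      by (intro Bochner_Integration.integral_cong refl) (auto simp: indicator_def in_box_complex_iff)
    also have "\<dots> = 0"
      by (rule rect) auto
    finally show ?thesis
      using int_pm nonneg by (simp add: emeasure_box)
  qed
  \<comment> \<open>Open boxes form a generator stable under intersection, so the measures with
    densities \<open>hp\<close> and \<open>hm\<close> coincide; uniqueness of densities then gives
    equality almost everywhere.\<close>
  have "density gauss (\<lambda>z. ennreal (hp z)) = density gauss (\<lambda>z. ennreal (hm z))"
  proof (rule measure_eqI_generator_eq)
    let ?E = "range (\<lambda>(a, b). box a b :: complex set)"
    show "Int_stable ?E"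
      by (auto simp: Int_stable_def box_Int_box)
    show "?E \<subseteq> Pow UNIV" "sets (density gauss (\<lambda>z. ennreal (hp z))) = sigma_sets UNIV ?E"
      "sets (density gauss (\<lambda>z. ennreal (hm z))) = sigma_sets UNIV ?E"
      by (simp_all add: borel_eq_box)
    let ?A = "\<lambda>n::nat. box (- (real n *\<^sub>R One)) (real n *\<^sub>R One) :: complex set"
    show "range ?A \<subseteq> ?E" "(\<Union>i. ?A i) = UNIV"
      unfolding UN_box_eq_UNIV by auto
    show "emeasure (density gauss (\<lambda>z. ennreal (hp z))) (?A i) \<noteq> \<infinity>" for i
      using int_pm nonneg by (simp add: emeasure_box)
    show "emeasure (density gauss (\<lambda>z. ennreal (hp z))) X = emeasure (density gauss (\<lambda>z. ennreal (hm z))) X"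
      if "X \<in> ?E" for X
      using that eq_box by auto
  qed
  then have "AE z in gauss. ennreal (hp z) = ennreal (hm z)"
    by (intro gauss.density_unique) auto
  then show ?thesis
    by eventually_elim (use nonneg in \<open>simp add: h_eq\<close>)
qed

text \<open>\<open>hermite_add\<close> with parameters 2 and -2 sums to parameter 0, which writes a
  monomial as a combination of the unnormalised J.\<close>

lemma L2_inner_monomial_eq_0:
  assumes h: "L2 h" and orth: "\<And>m n. L2_inner h (J m n) = 0"
  shows "L2_inner h (\<lambda>z. z ^ p * cnj z ^ q) = 0"
proof -
  have "L2_inner (\<lambda>z. J_const m n * hermite (-2) m n z) h = 0" for m n
    using orth[of m n] L2_inner_commute[of "J m n" h] by (simp add: J_eq_hermite[abs_def])
  then have "L2_inner (hermite (-2) m n) h = 0" for m n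
    unfolding L2_inner_cmult_left using J_const_pos[of m n] by (metis mult_eq_0_iff of_real_eq_0_iff less_irrefl)
  then have "L2_inner (\<lambda>z. \<Sum>r\<le>p. 2 ^ r * fact r * of_nat (p choose r) * of_nat (q choose r) * hermite (-2) (p - r) (q - r) z) h = 0"
    by (subst L2_inner_sum_left) (auto intro!: L2_cmult L2_hermite h simp: L2_inner_cmult_left)
  then have "L2_inner (\<lambda>z. z ^ p * cnj z ^ q) h = 0"
    unfolding hermite_add by (simp add: hermite_0)
  then show ?thesis
    using L2_inner_commute[of h "\<lambda>z. z ^ p * cnj z ^ q"] by simp
qed

lemma L2_inner_Re_Im_monomial_eq_0:
  assumes h: "L2 h" and orth: "\<And>p q. L2_inner h (\<lambda>z. z ^ p * cnj z ^ q) = 0"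
  shows "(LINT z|gauss. h z * complex_of_real (Re z ^ i * Im z ^ j)) = 0"
proof -
  let ?c = "\<lambda>k l. of_nat (i choose k) * of_nat (j choose l) * (-1) ^ (j - l) / (2 ^ i * (2 * \<i>) ^ j)"
  have expand: "complex_of_real (Re z ^ i * Im z ^ j) =
      (\<Sum>k\<le>i. \<Sum>l\<le>j. ?c k l * (z ^ (k + l) * cnj z ^ ((i - k) + (j - l))))" for z
  proof -
    have "complex_of_real (Re z) = (z + cnj z) / 2" "complex_of_real (Im z) = (z + (-1) * cnj z) / (2 * \<i>)"
      by (auto simp: complex_eq_iff Re_divide Im_divide)
    then have "complex_of_real (Re z ^ i * Im z ^ j) = (z + cnj z) ^ i * (z + (-1) * cnj z) ^ j / (2 ^ i * (2 * \<i>) ^ j)"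
      by (simp only: of_real_mult of_real_power power_divide times_divide_times_eq)
    then show ?thesis
      unfolding binomial_ring sum_product sum_divide_distrib power_mult_distrib[of "-1"] power_add
      by (simp only: mult_ac times_divide_eq_left times_divide_eq_right)
  qed
  have "L2_inner (\<lambda>z. z ^ p * cnj z ^ q) h = 0" for p q
    using orth[of p q] L2_inner_commute[of "\<lambda>z. z ^ p * cnj z ^ q" h] by simp
  then have "L2_inner (\<lambda>z. \<Sum>k\<le>i. \<Sum>l\<le>j. ?c k l * (z ^ (k + l) * cnj z ^ ((i - k) + (j - l)))) h = 0"
    by (subst L2_inner_sum_left, (intro L2_sum L2_cmult L2_monomial h)+,
        subst L2_inner_sum_left, (intro L2_sum L2_cmult L2_monomial h)+,
        subst L2_inner_cmult_left) simp
  then have "L2_inner (\<lambda>z. complex_of_real (Re z ^ i * Im z ^ j)) h = 0"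
    unfolding expand .
  then have "L2_inner h (\<lambda>z. complex_of_real (Re z ^ i * Im z ^ j)) = 0"
    using L2_inner_commute[of h "\<lambda>z. complex_of_real (Re z ^ i * Im z ^ j)"] by simp
  then show ?thesis
    by (simp add: L2_inner_def)
qed

text \<open>The test polynomials in \<open>Re z\<close> and \<open>Im z\<close> are real, so the
  real and imaginary parts of h have vanishing moments separately and the real-valued uniqueness
  result applies to each.\<close>

lemma J_total:
  assumes h: "L2 h" and orth: "\<And>m n. L2_inner h (J m n) = 0"
  shows "AE z in gauss. h z = 0"
proof -
  note [measurable] = L2_measurable[OF h]
  have zero: "(LINT z|gauss. h z * complex_of_real (Re z ^ i * Im z ^ j)) = 0" for i j
    by (rule L2_inner_Re_Im_monomial_eq_0[OF h L2_inner_monomial_eq_0[OF h orth]])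
  have L2_poly: "L2 (\<lambda>z. complex_of_real (Re z ^ i * Im z ^ j))" for i j
  proof (rule L2I)
    have "integrable gauss (\<lambda>z. Re z ^ (2 * i) * Im z ^ (2 * j))"
      using has_bochner_integral_gauss_monomial by (auto simp: has_bochner_integral_iff)
    then show "integrable gauss (\<lambda>z. (cmod (complex_of_real (Re z ^ i * Im z ^ j)))\<^sup>2)"
      unfolding norm_of_real power2_abs power_mult_distrib power_mult[symmetric] by (simp add: mult.commute)
  qed measurable
  have int: "integrable gauss (\<lambda>z. h z * complex_of_real (Re z ^ i * Im z ^ j))" for i j
    by (rule L2_integrable_mult(1)[OF h L2_poly])
  have L2_part: "L2 (\<lambda>z. complex_of_real (Re (h z)))" "L2 (\<lambda>z. complex_of_real (Im (h z)))"
    by (rule L2I; (rule Bochner_Integration.integrable_bound[OF L2_integrable[OF h]])?;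
        force simp: abs_square_le_1 cmod_def)+
  have Re0: "(LINT z|gauss. Re (h z) * (Re z ^ i * Im z ^ j)) = 0" for i j
    using integral_Re[OF int[of i j]] zero[of i j] by simp
  have Im0: "(LINT z|gauss. Im (h z) * (Re z ^ i * Im z ^ j)) = 0" for i j
    using integral_Im[OF int[of i j]] zero[of i j] by simp
  have "AE z in gauss. Re (h z) = 0" "AE z in gauss. Im (h z) = 0"
    by (intro integral_gauss_eq_0_imp_AE_0_real L2_part Re0 Im0)+
  then show ?thesis
    by eventually_elim (simp add: complex_eq_iff)
qed


section \<open>Fourier coefficients: Bessel, Riesz-Fischer and Parseval\<close>

definition J_pair :: "nat \<times> nat \<Rightarrow> complex \<Rightarrow> complex" where
  "J_pair k = J (fst k) (snd k)"

definition coef :: "(complex \<Rightarrow> complex) \<Rightarrow> nat \<times> nat \<Rightarrow> complex" where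
  "coef f k = L2_inner f (J_pair k)"

lemma L2_J_pair: "L2 (J_pair k)"
  by (simp add: J_pair_def L2_J)

lemma L2_inner_J_pair: "L2_inner (J_pair k) (J_pair l) = (if k = l then 1 else 0)"
  by (simp add: J_pair_def J_orthonormal prod_eq_iff)

lemma L2_norm_J_pair: "L2_norm (J_pair k) = 1"
proof -
  have "complex_of_real ((L2_norm (J_pair k))\<^sup>2) = 1"
    unfolding L2_inner_self[symmetric] L2_inner_J_pair by simp
  then have "(L2_norm (J_pair k))\<^sup>2 = 1"
    unfolding of_real_eq_1_iff .
  then show ?thesis
    using L2_norm_nonneg[of "J_pair k"] by (simp add: power2_eq_1_iff)
qed

lemma L2_J_sum: "L2 (\<lambda>z. \<Sum>k\<in>F. a k * J_pair k z)"
  by (intro L2_sum L2_cmult L2_J_pair)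

lemma coef_diff: "L2 f \<Longrightarrow> L2 g \<Longrightarrow> coef (\<lambda>z. f z - g z) k = coef f k - coef g k"
  by (simp add: coef_def L2_inner_diff_left L2_J_pair)

lemma coef_cmult: "coef (\<lambda>z. a * f z) k = a * coef f k"
  by (simp add: coef_def L2_inner_cmult_left)

lemma coef_cong_AE: "L2 f \<Longrightarrow> L2 g \<Longrightarrow> AE z in gauss. f z = g z \<Longrightarrow> coef f k = coef g k"
  unfolding coef_def by (rule L2_inner_cong_AE[OF _ _ L2_J_pair])

lemma norm_coef_le: "L2 f \<Longrightarrow> cmod (coef f k) \<le> L2_norm f"
  using L2_Cauchy_Schwarz[OF _ L2_J_pair] by (simp add: coef_def L2_norm_J_pair)

lemma coef_J_sum: "finite F \<Longrightarrow> coef (\<lambda>z. \<Sum>k\<in>F. a k * J_pair k z) l = (if l \<in> F then a l else 0)"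
  unfolding coef_def
  by (subst L2_inner_sum_left)
     (auto intro!: L2_cmult L2_J_pair simp: L2_inner_cmult_left L2_inner_J_pair if_distrib[where f="\<lambda>x. _ * x"] cong: if_cong)

lemma L2_inner_J_sum:
  assumes "L2 f"
  shows "L2_inner f (\<lambda>z. \<Sum>k\<in>F. a k * J_pair k z) = (\<Sum>k\<in>F. cnj (a k) * coef f k)"
proof -
  have "L2_inner (\<lambda>z. \<Sum>k\<in>F. a k * J_pair k z) f = (\<Sum>k\<in>F. a k * cnj (coef f k))"
    by (subst L2_inner_sum_left)
       (auto intro!: L2_cmult L2_J_pair assms sum.cong simp: L2_inner_cmult_left coef_def L2_inner_commute[symmetric])
  then show ?thesis
    using L2_inner_commute[of f "\<lambda>z. \<Sum>k\<in>F. a k * J_pair k z"] by simp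
qed

lemma L2_norm_J_sum:
  assumes "finite F"
  shows "(L2_norm (\<lambda>z. \<Sum>k\<in>F. a k * J_pair k z))\<^sup>2 = (\<Sum>k\<in>F. (cmod (a k))\<^sup>2)"
proof -
  let ?S = "\<lambda>z. \<Sum>k\<in>F. a k * J_pair k z"
  have "complex_of_real ((L2_norm ?S)\<^sup>2) = (\<Sum>k\<in>F. cnj (a k) * coef ?S k)"
    unfolding L2_inner_self[symmetric] by (rule L2_inner_J_sum[OF L2_J_sum])
  also have "\<dots> = complex_of_real (\<Sum>k\<in>F. (cmod (a k))\<^sup>2)"
    unfolding of_real_sum using assms
    by (intro sum.cong refl) (simp add: coef_J_sum complex_norm_square mult.commute del: of_real_power)
  finally show ?thesis
    unfolding of_real_eq_iff .
qed

lemma L2_norm_residual: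
  assumes "L2 f" "finite F"
  shows "(L2_norm (\<lambda>z. f z - (\<Sum>k\<in>F. coef f k * J_pair k z)))\<^sup>2 = (L2_norm f)\<^sup>2 - (\<Sum>k\<in>F. (cmod (coef f k))\<^sup>2)"
proof -
  have "L2_inner f (\<lambda>z. \<Sum>k\<in>F. coef f k * J_pair k z) = complex_of_real (\<Sum>k\<in>F. (cmod (coef f k))\<^sup>2)"
    unfolding L2_inner_J_sum[OF assms(1)] of_real_sum complex_norm_square
    by (simp add: mult.commute)
  then show ?thesis
    unfolding L2_norm_diff_power2[OF assms(1) L2_J_sum] L2_norm_J_sum[OF assms(2)] by simp
qed

lemma Bessel:
  assumes "L2 f"
  shows "(\<lambda>k. (cmod (coef f k))\<^sup>2) summable_on UNIV"
proof (rule nonneg_bdd_above_summable_on)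
  have "(\<Sum>k\<in>F. (cmod (coef f k))\<^sup>2) \<le> (L2_norm f)\<^sup>2" if "finite F" for F
    using L2_norm_residual[OF assms that] zero_le_power2[of "L2_norm (\<lambda>z. f z - (\<Sum>k\<in>F. coef f k * J_pair k z))"]
    by simp
  then show "bdd_above (sum (\<lambda>k. (cmod (coef f k))\<^sup>2) ` {F. F \<subseteq> UNIV \<and> finite F})"
    by (intro bdd_aboveI2) auto
qed simp

text \<open>Enumerating the pairs by \<open>prod_decode\<close> produces the sequence that
  \<open>L2_complete\<close> asks for. Convergence along this enumeration stays in the conclusion
  because Parseval uses it.\<close>

lemma Riesz_Fischer:
  assumes a: "(\<lambda>k. (cmod (a k))\<^sup>2) summable_on UNIV"
  shows "\<exists>g. L2 g \<and> (\<forall>k. coef g k = a k) \<and>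
    (\<lambda>n. L2_norm (\<lambda>z. g z - (\<Sum>k\<in>prod_decode ` {..<n}. a k * J_pair k z))) \<longlonglongrightarrow> 0"
proof -
  let ?S = "\<lambda>n z. \<Sum>k\<in>prod_decode ` {..<n}. a k * J_pair k z"
  have inj: "inj_on prod_decode X" for X
    by (rule inj_prod_decode)
  have "(\<lambda>i. (cmod (a (prod_decode i)))\<^sup>2) summable_on UNIV"
    using a summable_on_reindex_bij_betw[OF bij_prod_decode, of "\<lambda>k. (cmod (a k))\<^sup>2"] by simp
  then have summ: "summable (\<lambda>i. (cmod (a (prod_decode i)))\<^sup>2)"
    by (rule summable_on_imp_summable)
  have diff_norm: "(L2_norm (\<lambda>z. ?S n z - ?S m z))\<^sup>2 = (\<Sum>i=m..<n. (cmod (a (prod_decode i)))\<^sup>2)" if "m \<le> n" for m n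
  proof -
    have "{..<n} = {..<m} \<union> {m..<n}" using that by auto
    then have "?S n z - ?S m z = (\<Sum>k\<in>prod_decode ` {m..<n}. a k * J_pair k z)" for z
      by (simp add: sum.reindex[OF inj] sum.union_disjoint ivl_disj_int)
    then have "(L2_norm (\<lambda>z. ?S n z - ?S m z))\<^sup>2 = (\<Sum>k\<in>prod_decode ` {m..<n}. (cmod (a k))\<^sup>2)"
      by (simp only: L2_norm_J_sum finite_imageI finite_atLeastLessThan)
    then show ?thesis
      by (simp only: sum.reindex[OF inj] o_def)
  qed
  have "\<exists>N. \<forall>m\<ge>N. \<forall>n\<ge>N. L2_norm (\<lambda>z. ?S m z - ?S n z) < e" if e: "0 < e" for e
  proof -
    from summ e obtain N where N: "\<And>m n. m \<ge> N \<Longrightarrow> \<bar>\<Sum>i=m..<n. (cmod (a (prod_decode i)))\<^sup>2\<bar> < e\<^sup>2"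
      unfolding summable_Cauchy real_norm_def by (meson zero_less_power)
    have ord: "L2_norm (\<lambda>z. ?S n z - ?S m z) < e" if "N \<le> m" "m \<le> n" for m n
    proof -
      have "(L2_norm (\<lambda>z. ?S n z - ?S m z))\<^sup>2 < e\<^sup>2"
        using N[of m n] that by (simp add: diff_norm)
      then show ?thesis
        by (rule power2_less_imp_less) (use e in simp)
    qed
    have swap: "L2_norm (\<lambda>z. ?S m z - ?S n z) = L2_norm (\<lambda>z. ?S n z - ?S m z)" for m n
      by (simp add: L2_norm_def norm_minus_commute)
    show ?thesis
    proof (intro exI allI impI)
      fix m n assume "N \<le> m" "N \<le> n"
      then show "L2_norm (\<lambda>z. ?S m z - ?S n z) < e"
        using ord[of m n] ord[of n m] swap[of m n] by (cases "m \<le> n") auto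
    qed
  qed
  from L2_complete[OF L2_J_sum this] obtain g where g: "L2 g" "(\<lambda>n. L2_norm (\<lambda>z. g z - ?S n z)) \<longlonglongrightarrow> 0"
    by blast
  have "coef g k = a k" for k
  proof -
    have "(\<lambda>n. coef g k - coef (?S n) k) \<longlonglongrightarrow> 0"
    proof (rule Lim_null_comparison[OF _ g(2)])
      show "\<forall>\<^sub>F n in sequentially. norm (coef g k - coef (?S n) k) \<le> L2_norm (\<lambda>z. g z - ?S n z)"
        using norm_coef_le[OF L2_diff[OF g(1) L2_J_sum]] by (simp add: coef_diff g L2_J_sum)
    qed
    \<comment> \<open>Once k has been enumerated, the coefficient of the partial sum is constantly
      \<open>a k\<close>.\<close>
    moreover have "\<forall>\<^sub>F n in sequentially. coef g k - coef (?S n) k = coef g k - a k"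
      using eventually_gt_at_top[of "prod_encode k"]
    proof eventually_elim
      case (elim n)
      then have "k \<in> prod_decode ` {..<n}"
        by (intro image_eqI[of _ _ "prod_encode k"]) auto
      then show ?case by (simp add: coef_J_sum)
    qed
    ultimately have "(\<lambda>n. coef g k - a k) \<longlonglongrightarrow> 0"
      by (rule Lim_transform_eventually)
    then show ?thesis
      by (simp add: LIMSEQ_const_iff)
  qed
  with g show ?thesis by blast
qed

lemma coef_eq_imp_AE_eq:
  assumes "L2 f" "L2 g" "\<And>k. coef f k = coef g k"
  shows "AE z in gauss. f z = g z"
proof -
  have "L2_inner (\<lambda>z. f z - g z) (J m n) = 0" for m n
    using coef_diff[OF assms(1,2), of "(m, n)"] assms(3)[of "(m, n)"] by (simp add: coef_def J_pair_def)
  then have "AE z in gauss. f z - g z = 0"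
    using J_total[OF L2_diff[OF assms(1,2)]] by blast
  then show ?thesis by simp
qed

text \<open>Riesz-Fischer yields a g with the coefficients of f whose partial sums converge to it;
  completeness of the system gives g = f almost everywhere, so the residual in Bessel's identity
  tends to zero.\<close>

lemma Parseval:
  assumes f: "L2 f"
  shows "((\<lambda>k. (cmod (coef f k))\<^sup>2) has_sum (L2_norm f)\<^sup>2) UNIV"
proof -
  obtain g where g: "L2 g" "\<And>k. coef g k = coef f k"
    and lim: "(\<lambda>n. L2_norm (\<lambda>z. g z - (\<Sum>k\<in>prod_decode ` {..<n}. coef f k * J_pair k z))) \<longlonglongrightarrow> 0"
    using Riesz_Fischer[OF Bessel[OF f]] by blast
  have fg: "AE z in gauss. g z = f z"
    by (rule coef_eq_imp_AE_eq[OF g(1) f g(2)])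
  have inj: "inj_on prod_decode X" for X
    by (rule inj_prod_decode)
  have "(L2_norm (\<lambda>z. g z - (\<Sum>k\<in>prod_decode ` {..<n}. coef f k * J_pair k z)))\<^sup>2
      = (L2_norm f)\<^sup>2 - (\<Sum>i<n. (cmod (coef f (prod_decode i)))\<^sup>2)" for n
    using L2_norm_residual[OF g(1), of "prod_decode ` {..<n}"] L2_norm_cong_AE[OF g(1) f fg]
    by (simp add: g(2) sum.reindex[OF inj])
  then have "(\<lambda>n. (L2_norm f)\<^sup>2 - (\<Sum>i<n. (cmod (coef f (prod_decode i)))\<^sup>2)) \<longlonglongrightarrow> 0"
    using tendsto_power[OF lim, of 2] by simp
  then have "(\<lambda>n. (L2_norm f)\<^sup>2 - ((L2_norm f)\<^sup>2 - (\<Sum>i<n. (cmod (coef f (prod_decode i)))\<^sup>2))) \<longlonglongrightarrow> (L2_norm f)\<^sup>2 - 0"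
    by (intro tendsto_intros)
  then have "(\<lambda>i. (cmod (coef f (prod_decode i)))\<^sup>2) sums (L2_norm f)\<^sup>2"
    by (simp add: sums_def)
  then have "((\<lambda>i. (cmod (coef f (prod_decode i)))\<^sup>2) has_sum (L2_norm f)\<^sup>2) UNIV"
    by (rule sums_nonneg_imp_has_sum) simp
  then show ?thesis
    using has_sum_reindex_bij_betw[OF bij_prod_decode, of "\<lambda>k. (cmod (coef f k))\<^sup>2"] by simp
qed

section \<open>The semigroup in the Hermite basis\<close>

text \<open>The squared residual is the tail of Parseval's sum, so unconditional summability gives
  convergence over finite sets, the mode of convergence in \<open>L_op_is\<close>.\<close>

lemma J_expansion_converges:
  assumes g: "L2 g" and e: "0 < e"
  shows "\<exists>F0. finite F0 \<and> (\<forall>F. finite F \<and> F0 \<subseteq> F \<longrightarrow>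
    L2_norm (\<lambda>z. g z - (\<Sum>k\<in>F. coef g k * J_pair k z)) < e)"
proof -
  have "(sum (\<lambda>k. (cmod (coef g k))\<^sup>2) \<longlongrightarrow> (L2_norm g)\<^sup>2) (finite_subsets_at_top UNIV)"
    using Parseval[OF g] by (simp add: has_sum_def)
  then have "\<forall>\<^sub>F F in finite_subsets_at_top UNIV. (L2_norm g)\<^sup>2 - e\<^sup>2 < (\<Sum>k\<in>F. (cmod (coef g k))\<^sup>2)"
    by (rule order_tendstoD) (use e in simp)
  then obtain F0 where F0: "finite F0"
    "\<And>F. finite F \<Longrightarrow> F0 \<subseteq> F \<Longrightarrow> (L2_norm g)\<^sup>2 - e\<^sup>2 < (\<Sum>k\<in>F. (cmod (coef g k))\<^sup>2)"
    unfolding eventually_finite_subsets_at_top by auto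
  have "L2_norm (\<lambda>z. g z - (\<Sum>k\<in>F. coef g k * J_pair k z)) < e" if "finite F" "F0 \<subseteq> F" for F
  proof (rule power2_less_imp_less)
    show "(L2_norm (\<lambda>z. g z - (\<Sum>k\<in>F. coef g k * J_pair k z)))\<^sup>2 < e\<^sup>2"
      using F0(2)[OF that] by (simp add: L2_norm_residual[OF g that(1)])
  qed (use e in simp)
  with F0(1) show ?thesis by blast
qed

text \<open>The tail of u outside F is at most the tail of v. This splitting into head and tail
  serves as dominated convergence for series.\<close>

lemma has_sum_dominated_le:
  fixes u v :: "'a \<Rightarrow> real"
  assumes "(u has_sum A) UNIV" "(v has_sum B) UNIV" "\<And>k. u k \<le> v k" "finite F"
  shows "A \<le> sum u F + (B - sum v F)"
proof -
  have "((\<lambda>k. v k - u k) has_sum (B - A)) UNIV"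
    using has_sum_add[OF assms(2) has_sum_uminusI[OF assms(1)]] by simp
  moreover have "((\<lambda>k. v k - u k) has_sum (\<Sum>k\<in>F. v k - u k)) F"
    using assms(4) by (rule has_sum_finite)
  ultimately have "(\<Sum>k\<in>F. v k - u k) \<le> B - A"
    using assms(3) by (elim has_sum_mono_neutral[rotated]) auto
  then show ?thesis by (simp add: sum_subtractf)
qed

section \<open>Eigenvalues, the exponential multiplier and the Mehler integral\<close>

definition eigenvalue :: "real \<Rightarrow> nat \<times> nat \<Rightarrow> complex" where
  "eigenvalue \<theta> k = lam \<theta> (fst k) (snd k)"

text \<open>Identifies the weight in \<open>L_dom\<close>, so that membership means
  square-summability of the coefficients multiplied by the eigenvalues.\<close>

lemma norm_lam_power2:
  "(cmod (lam \<theta> m n))\<^sup>2 = real m ^ 2 + real n ^ 2 + 2 * real m * real n * cos (2 * \<theta>)"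
proof -
  have identity: "((a + b) * c)\<^sup>2 + ((a - b) * s)\<^sup>2 = (a\<^sup>2 + b\<^sup>2) * (s\<^sup>2 + c\<^sup>2) + 2 * a * b * (c\<^sup>2 - s\<^sup>2)"
    for a b c s :: real
    by (simp add: power2_eq_square algebra_simps)
  have "(cmod (lam \<theta> m n))\<^sup>2 = (real (m + n) * cos \<theta>)\<^sup>2 + ((real m - real n) * sin \<theta>)\<^sup>2"
    by (simp add: cmod_power2 lam_def)
  also have "\<dots> = (real m ^ 2 + real n ^ 2) * ((sin \<theta>)\<^sup>2 + (cos \<theta>)\<^sup>2) + 2 * real m * real n * ((cos \<theta>)\<^sup>2 - (sin \<theta>)\<^sup>2)"
    by (simp only: identity of_nat_add)
  finally show ?thesis
    by (simp add: cos_double)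
qed

text \<open>Mean value inequality on the closed left half-plane, which is convex and where the
  derivative of exp has modulus at most 1.\<close>

lemma norm_exp_minus_1_le:
  fixes w :: complex
  assumes "Re w \<le> 0"
  shows "cmod (exp w - 1) \<le> cmod w"
proof -
  have "cmod (exp w - exp 0) \<le> 1 * cmod (w - 0)"
  proof (rule field_differentiable_bound[where S="{z. Re z \<le> 0}" and f'=exp])
    show "convex {z. Re z \<le> 0}" by (rule convex_halfspace_Re_le)
    show "(exp has_field_derivative exp z) (at z within {z. Re z \<le> 0})" for z :: complex
      by (rule DERIV_exp[THEN has_field_derivative_at_within])
  qed (use assms in auto)
  then show ?thesis by simp
qed

lemma exp_difference_quotient_tendsto:
  "((\<lambda>t. (exp (- (complex_of_real t * l)) - 1) / complex_of_real t) \<longlongrightarrow> - l) (at_right 0)"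
proof -
  have "((\<lambda>w. exp (- (w * l))) has_field_derivative - l) (at 0)"
    by (auto intro!: derivative_eq_intros)
  then have "((\<lambda>w. (exp (- (w * l)) - 1) / w) \<longlongrightarrow> - l) (at 0)"
    by (simp add: has_field_derivative_iff)
  moreover have "filterlim complex_of_real (at 0) (at_right 0)"
    unfolding filterlim_at
    by (auto intro!: tendsto_eq_intros simp: eventually_at_filter)
  ultimately show ?thesis
    by (rule filterlim_compose)
qed

definition drift :: "real \<Rightarrow> real \<Rightarrow> complex" where
  "drift \<theta> t = exp (- (complex_of_real (cos \<theta>) + \<i> * complex_of_real (sin \<theta>)) * complex_of_real t)"

definition diffusion :: "real \<Rightarrow> real \<Rightarrow> real" where
  "diffusion \<theta> t = sqrt (1 - exp (- 2 * t * cos \<theta>))"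

lemma P_eq: "P \<theta> t \<phi> x = (LINT y|gauss. \<phi> (drift \<theta> t * x + diffusion \<theta> t * y))"
  by (simp add: P_def drift_def diffusion_def)

text \<open>The invariance relation of the Gaussian measure, in the form of the hypothesis of
  \<open>J_Mehler\<close>. The sign conditions keep the argument of the square root
  nonnegative.\<close>

lemma drift_diffusion:
  assumes "0 \<le> cos \<theta>" "0 \<le> t"
  shows "drift \<theta> t * cnj (drift \<theta> t) + (diffusion \<theta> t)\<^sup>2 = 1"
proof -
  have "drift \<theta> t * cnj (drift \<theta> t) = complex_of_real ((cmod (drift \<theta> t))\<^sup>2)"
    by (simp only: complex_norm_square)
  also have "(cmod (drift \<theta> t))\<^sup>2 = exp (- 2 * t * cos \<theta>)"
    by (simp add: drift_def power2_eq_square exp_add[symmetric] mult_ac)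
  finally have "drift \<theta> t * cnj (drift \<theta> t) = complex_of_real (exp (- 2 * t * cos \<theta>))" .
  moreover have "(diffusion \<theta> t)\<^sup>2 = 1 - exp (- 2 * t * cos \<theta>)"
    using assms by (simp add: diffusion_def)
  ultimately show ?thesis
    by (simp add: of_real_diff[symmetric] of_real_add[symmetric] del: of_real_diff of_real_add)
qed

text \<open>\<open>lam \<theta> m n\<close> is m copies of the drift rate plus n copies of its
  conjugate.\<close>

lemma drift_power: "drift \<theta> t ^ m * cnj (drift \<theta> t) ^ n = exp (- (complex_of_real t * lam \<theta> m n))"
  unfolding drift_def exp_cnj exp_of_nat_mult[symmetric] exp_add[symmetric]
  by (simp add: lam_def algebra_simps)

lemma P_J:
  assumes "0 \<le> cos \<theta>" "0 \<le> t"
  shows "P \<theta> t (J m n) x = exp (- (complex_of_real t * lam \<theta> m n)) * J m n x"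
    and "integrable gauss (\<lambda>y. J m n (drift \<theta> t * x + diffusion \<theta> t * y))"
  using J_Mehler[OF drift_diffusion[OF assms], of m n x]
  by (simp_all add: P_eq has_bochner_integral_iff drift_power)

text \<open>Radial retraction onto the ball of radius \<open>Suc n\<close>. The successor keeps the
  denominator positive, so the map is continuous for n = 0 as well.\<close>

definition truncate :: "nat \<Rightarrow> complex \<Rightarrow> complex" where
  "truncate n w = complex_of_real (Suc n / max (Suc n) (cmod w)) * w"

lemma truncate_eq: "cmod w \<le> Suc n \<Longrightarrow> truncate n w = w"
  by (simp add: truncate_def max_def)

lemma norm_truncate_le: "cmod (truncate n w) \<le> Suc n" "cmod (truncate n w) \<le> cmod w"
proof -
  have *: "cmod (truncate n w) = Suc n / max (Suc n) (cmod w) * cmod w"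
    unfolding truncate_def norm_mult norm_of_real by simp
  have "cmod (truncate n w) = min (Suc n) (cmod w)"
    unfolding * by (cases "cmod w \<le> Suc n") (auto simp: max_def min_def)
  then show "cmod (truncate n w) \<le> Suc n" "cmod (truncate n w) \<le> cmod w"
    by simp_all
qed

lemma continuous_on_truncate: "continuous_on S (truncate n)"
  unfolding truncate_def[abs_def] by (intro continuous_intros) (auto simp: max_def)

lemma truncate_tendsto: "(\<lambda>n. truncate n w) \<longlonglongrightarrow> w"
proof (rule tendsto_eventually)
  show "\<forall>\<^sub>F n in sequentially. truncate n w = w"
    using eventually_ge_at_top[of "nat \<lceil>cmod w\<rceil>"]
    by eventually_elim (rule truncate_eq, linarith)
qed

section \<open>The semigroup and its generator in Hermite coordinates\<close>

context
  fixes \<theta> :: real and T :: "real \<Rightarrow> (complex \<Rightarrow> complex) \<Rightarrow> (complex \<Rightarrow> complex)"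
  assumes theta: "- (pi / 2) < \<theta>" "\<theta> < pi / 2"
    and semigroup: "is_L2_extension_semigroup \<theta> T"
begin

lemma cos_theta: "0 < cos \<theta>"
  using theta by (intro cos_gt_zero_pi) auto

lemmas semigroup_conj = semigroup[unfolded is_L2_extension_semigroup_def]

lemma L2_T: "0 \<le> t \<Longrightarrow> L2 f \<Longrightarrow> L2 (T t f)"
  by (rule semigroup_conj[THEN conjunct1, rule_format])

lemma T_linear: "0 \<le> t \<Longrightarrow> L2 f \<Longrightarrow> L2 g \<Longrightarrow>
    AE z in gauss. T t (\<lambda>w. a * f w + b * g w) z = a * T t f z + b * T t g z"
  by (rule semigroup_conj[THEN conjunct2, THEN conjunct1, rule_format])

lemma T_contraction: "0 \<le> t \<Longrightarrow> L2 f \<Longrightarrow> L2_norm (T t f) \<le> L2_norm f"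
  by (rule semigroup_conj[THEN conjunct2, THEN conjunct2, THEN conjunct1, rule_format])

lemma T_eq_P_bounded: "0 \<le> t \<Longrightarrow> continuous_on UNIV \<phi> \<Longrightarrow> bounded (range \<phi>) \<Longrightarrow>
    AE z in gauss. T t \<phi> z = P \<theta> t \<phi> z"
  by (rule semigroup_conj[THEN conjunct2, THEN conjunct2, THEN conjunct2, THEN conjunct2,
      THEN conjunct2, THEN conjunct2, rule_format])

lemma T_contraction_diff:
  assumes t: "0 \<le> t" and f: "L2 f" and g: "L2 g"
  shows "L2_norm (\<lambda>z. T t f z - T t g z) \<le> L2_norm (\<lambda>z. f z - g z)"
proof -
  have "AE z in gauss. T t (\<lambda>w. f w - g w) z = T t f z - T t g z"
    using T_linear[OF t f g, of 1 "-1"] by simp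
  then have "L2_norm (T t (\<lambda>w. f w - g w)) = L2_norm (\<lambda>z. T t f z - T t g z)"
    by (intro L2_norm_cong_AE L2_T L2_diff t f g)
  then show ?thesis
    using T_contraction[OF t L2_diff[OF f g]] by simp
qed

text \<open>Truncations of \<phi> converge to it in L2, so contractivity carries the convergence
  over to T; the Mehler integrals converge pointwise by dominated convergence. An almost everywhere
  convergent subsequence makes the two limits comparable.\<close>

lemma T_eq_P:
  assumes t: "0 \<le> t" and cont: "continuous_on UNIV \<phi>" and L2: "L2 \<phi>"
    and int: "\<And>x. integrable gauss (\<lambda>y. \<phi> (drift \<theta> t * x + diffusion \<theta> t * y))"
  shows "AE z in gauss. T t \<phi> z = P \<theta> t \<phi> z"
proof -
  define f where "f n z = truncate n (\<phi> z)" for n z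
  have cont_f: "continuous_on UNIV (f n)" for n
    unfolding f_def by (intro continuous_on_compose2[OF continuous_on_truncate[of UNIV] cont]) auto
  have [measurable]: "\<phi> \<in> borel_measurable borel" "f n \<in> borel_measurable borel" for n
    using cont cont_f by (auto intro!: borel_measurable_continuous_onI)
  have L2f: "L2 (f n)" for n
    by (rule L2_bounded[where B="Suc n"]) (use norm_truncate_le in \<open>auto simp: f_def\<close>)
  have "(\<lambda>n. LINT z|gauss. (cmod (f n z - \<phi> z))\<^sup>2) \<longlonglongrightarrow> (LINT z|gauss. 0)"
  proof (rule integral_dominated_convergence)
    show "integrable gauss (\<lambda>z. (2 * cmod (\<phi> z))\<^sup>2)"
      using L2_integrable[OF L2] by (simp add: power_mult_distrib)
    have "(\<lambda>n. (cmod (f n z - \<phi> z))\<^sup>2) \<longlonglongrightarrow> (cmod (\<phi> z - \<phi> z))\<^sup>2" for z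
      unfolding f_def by (intro tendsto_intros truncate_tendsto)
    then show "AE z in gauss. (\<lambda>n. (cmod (f n z - \<phi> z))\<^sup>2) \<longlonglongrightarrow> 0"
      by simp
    have bound: "cmod (f n z - \<phi> z) \<le> 2 * cmod (\<phi> z)" for n z
      using norm_triangle_ineq4[of "f n z" "\<phi> z"] norm_truncate_le(2)[of n "\<phi> z"] by (simp add: f_def)
    have "norm ((cmod (f n z - \<phi> z))\<^sup>2) \<le> (2 * cmod (\<phi> z))\<^sup>2" for n z
      unfolding real_norm_def abs_power2 by (rule power_mono[OF bound]) simp
    then show "AE z in gauss. norm ((cmod (f n z - \<phi> z))\<^sup>2) \<le> (2 * cmod (\<phi> z))\<^sup>2" for n
      by blast
  qed measurable
  then have lim: "(\<lambda>n. (L2_norm (\<lambda>z. f n z - \<phi> z))\<^sup>2) \<longlonglongrightarrow> 0"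
    by (simp add: L2_norm_power2)
  have "(\<lambda>n. (L2_norm (\<lambda>z. T t (f n) z - T t \<phi> z))\<^sup>2) \<longlonglongrightarrow> 0"
    by (rule Lim_null_comparison[OF _ lim])
       (auto intro!: always_eventually power_mono T_contraction_diff t L2f L2)
  then have "(\<lambda>n. LINT z|gauss. norm ((cmod (T t (f n) z - T t \<phi> z))\<^sup>2)) \<longlonglongrightarrow> 0"
    by (simp add: L2_norm_power2)
  \<comment> \<open>L2 convergence is read as L1 convergence of the squared distances.\<close>
  from tendsto_L1_AE_subseq[OF _ this] obtain r where r: "strict_mono r"
    and sub: "AE z in gauss. (\<lambda>n. (cmod (T t (f (r n)) z - T t \<phi> z))\<^sup>2) \<longlonglongrightarrow> 0"
    using L2_integrable[OF L2_diff[OF L2_T[OF t L2f] L2_T[OF t L2]]] by blast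
  \<comment> \<open>The exceptional null set may depend on n; countability allows a common
    one.\<close>
  have "AE z in gauss. \<forall>n. T t (f n) z = P \<theta> t (f n) z"
    unfolding AE_all_countable
  proof
    fix n
    have "bounded (range (f n))"
      using norm_truncate_le(1)[of n] by (auto simp: bounded_iff f_def)
    then show "AE z in gauss. T t (f n) z = P \<theta> t (f n) z"
      by (intro T_eq_P_bounded t cont_f)
  qed
  with sub show ?thesis
  proof eventually_elim
    case (elim z)
    have "(\<lambda>n. P \<theta> t (f n) z) \<longlonglongrightarrow> P \<theta> t \<phi> z"
      unfolding P_eq
    proof (rule integral_dominated_convergence)
      show "integrable gauss (\<lambda>y. cmod (\<phi> (drift \<theta> t * z + diffusion \<theta> t * y)))"
        using int by (rule integrable_norm)
    qed (measurable, auto simp: f_def truncate_tendsto norm_truncate_le)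
    then have "(\<lambda>n. P \<theta> t (f (r n)) z) \<longlonglongrightarrow> P \<theta> t \<phi> z"
      using LIMSEQ_subseq_LIMSEQ[OF _ r] by (auto simp: o_def)
    then have "(\<lambda>n. (cmod (P \<theta> t (f (r n)) z - T t \<phi> z))\<^sup>2) \<longlonglongrightarrow> (cmod (P \<theta> t \<phi> z - T t \<phi> z))\<^sup>2"
      by (intro tendsto_intros)
    moreover have "(\<lambda>n. (cmod (P \<theta> t (f (r n)) z - T t \<phi> z))\<^sup>2) \<longlonglongrightarrow> 0"
      using elim by simp
    ultimately have "(cmod (P \<theta> t \<phi> z - T t \<phi> z))\<^sup>2 = 0"
      by (rule LIMSEQ_unique)
    then show "T t \<phi> z = P \<theta> t \<phi> z" by simp
  qed
qed

lemma T_J_pair: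
  assumes t: "0 \<le> t"
  shows "AE z in gauss. T t (J_pair k) z = exp (- (complex_of_real t * eigenvalue \<theta> k)) * J_pair k z"
proof -
  note cos = less_imp_le[OF cos_theta]
  have "AE z in gauss. T t (J (fst k) (snd k)) z = P \<theta> t (J (fst k) (snd k)) z"
    by (rule T_eq_P[OF t continuous_J L2_J P_J(2)[OF cos t]])
  then show ?thesis
    unfolding P_J(1)[OF cos t] J_pair_def eigenvalue_def .
qed

lemma T_J_sum:
  assumes t: "0 \<le> t" and "finite F"
  shows "AE z in gauss. T t (\<lambda>z. \<Sum>k\<in>F. a k * J_pair k z) z =
    (\<Sum>k\<in>F. (a k * exp (- (complex_of_real t * eigenvalue \<theta> k))) * J_pair k z)"
  using \<open>finite F\<close>
proof (induction F rule: finite_induct)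
  case empty
  show ?case
    using T_linear[OF t L2_const L2_const, of 0 0 0 0] by simp
next
  case (insert x F)
  have "AE z in gauss. T t (\<lambda>w. a x * J_pair x w + 1 * (\<Sum>k\<in>F. a k * J_pair k w)) z =
     a x * T t (J_pair x) z + 1 * T t (\<lambda>w. \<Sum>k\<in>F. a k * J_pair k w) z"
    by (rule T_linear[OF t L2_J_pair L2_J_sum])
  with insert.IH T_J_pair[OF t, of x] show ?case
    by eventually_elim (use insert.hyps in simp)
qed

text \<open>Both sides are L2-continuous in f, and on finite sums of the J they agree.\<close>

lemma coef_T:
  assumes t: "0 \<le> t" and f: "L2 f"
  shows "coef (T t f) k = exp (- (complex_of_real t * eigenvalue \<theta> k)) * coef f k"
proof -
  have "cmod (coef (T t f) k - exp (- (complex_of_real t * eigenvalue \<theta> k)) * coef f k) < e" if "0 < e" for e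
  proof -
    obtain F0 where F0: "finite F0"
      "\<And>F. finite F \<Longrightarrow> F0 \<subseteq> F \<Longrightarrow> L2_norm (\<lambda>z. f z - (\<Sum>k\<in>F. coef f k * J_pair k z)) < e"
      using J_expansion_converges[OF f \<open>0 < e\<close>] by blast
    \<comment> \<open>Including k makes the k-th coefficient of the partial sum equal to that of f,
      so only the error on the T side has to be estimated.\<close>
    define F where "F = insert k F0"
    let ?S = "\<lambda>z. \<Sum>k\<in>F. coef f k * J_pair k z"
    have F: "finite F" "F0 \<subseteq> F" "k \<in> F"
      using F0 by (auto simp: F_def)
    have "coef (T t ?S) k = coef (\<lambda>z. \<Sum>k\<in>F. (coef f k * exp (- (complex_of_real t * eigenvalue \<theta> k))) * J_pair k z) k"
      by (rule coef_cong_AE[OF L2_T[OF t L2_J_sum] L2_J_sum T_J_sum[OF t F(1)]])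
    also have "\<dots> = coef f k * exp (- (complex_of_real t * eigenvalue \<theta> k))"
      using F by (subst coef_J_sum) auto
    finally have "cmod (coef (T t f) k - exp (- (complex_of_real t * eigenvalue \<theta> k)) * coef f k)
        = cmod (coef (\<lambda>z. T t f z - T t ?S z) k)"
      by (simp add: coef_diff L2_T t f L2_J_sum mult.commute[of "coef f k"])
    also have "\<dots> \<le> L2_norm (\<lambda>z. T t f z - T t ?S z)"
      by (intro norm_coef_le L2_diff L2_T t f L2_J_sum)
    also have "\<dots> \<le> L2_norm (\<lambda>z. f z - ?S z)"
      by (intro T_contraction_diff t f L2_J_sum)
    also have "\<dots> < e"
      using F by (intro F0(2)) auto
    finally show ?thesis .
  qed
  then have "\<not> 0 < cmod (coef (T t f) k - exp (- (complex_of_real t * eigenvalue \<theta> k)) * coef f k)"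
    by blast
  then show ?thesis by simp
qed

lemma L2_difference_quotient:
  assumes "0 \<le> t" "L2 f" "L2 g"
  shows "L2 (\<lambda>z. (T t f z - f z) / complex_of_real t - g z)"
proof -
  have "L2 (\<lambda>z. inverse (complex_of_real t) * (T t f z - f z) - g z)"
    by (intro L2_diff L2_cmult L2_T assms)
  then show ?thesis
    by (simp only: divide_inverse mult.commute)
qed

lemma coef_difference_quotient:
  assumes t: "0 \<le> t" and f: "L2 f" and g: "L2 g"
  shows "coef (\<lambda>z. (T t f z - f z) / complex_of_real t - g z) k =
    (exp (- (complex_of_real t * eigenvalue \<theta> k)) - 1) / complex_of_real t * coef f k - coef g k"
proof -
  have "coef (\<lambda>z. inverse (complex_of_real t) * (T t f z - f z) - g z) k =
     inverse (complex_of_real t) * (exp (- (complex_of_real t * eigenvalue \<theta> k)) * coef f k - coef f k) - coef g k"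
    by (simp add: coef_diff coef_cmult L2_cmult L2_diff L2_T t f g coef_T)
  then show ?thesis
    by (simp add: divide_inverse algebra_simps)
qed

text \<open>L2 convergence of difference quotients forces convergence of each coefficient.
  Conversely, the coefficient limits give L2 convergence because every difference is dominated by a
  fixed square-summable sequence.\<close>

lemma gen_is_iff:
  assumes f: "L2 f"
  shows "gen_is T f g \<longleftrightarrow> L2 g \<and> (\<forall>k. coef g k = - eigenvalue \<theta> k * coef f k)"
proof (intro iffI conjI allI)
  let ?q = "\<lambda>t z. (T t f z - f z) / complex_of_real t - g z"
  let ?d = "\<lambda>t k. (exp (- (complex_of_real t * eigenvalue \<theta> k)) - 1) / complex_of_real t * coef f k - coef g k"
  have pos: "\<forall>\<^sub>F t in at_right 0. 0 < (t::real)"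
    by (rule eventually_at_right_less)
  have d_lim: "((\<lambda>t. ?d t k) \<longlongrightarrow> - eigenvalue \<theta> k * coef f k - coef g k) (at_right 0)" for k
    by (intro tendsto_intros exp_difference_quotient_tendsto)
  {
    assume gen: "gen_is T f g"
    then show g: "L2 g" by (simp add: gen_is_def)
    fix k
    have "((\<lambda>t. ?d t k) \<longlongrightarrow> 0) (at_right 0)"
    proof (rule Lim_null_comparison)
      show "((\<lambda>t. L2_norm (?q t)) \<longlongrightarrow> 0) (at_right 0)"
        using gen by (simp add: gen_is_def)
      show "\<forall>\<^sub>F t in at_right 0. norm (?d t k) \<le> L2_norm (?q t)"
        using pos
      proof eventually_elim
        case (elim t)
        then have t: "0 \<le> t" by simp
        show ?case
          using norm_coef_le[OF L2_difference_quotient[OF t f g], of k]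
          by (simp add: coef_difference_quotient[OF t f g])
      qed
    qed
    from tendsto_unique[OF _ d_lim this] show "coef g k = - eigenvalue \<theta> k * coef f k"
      by simp
  next
    assume "L2 g \<and> (\<forall>k. coef g k = - eigenvalue \<theta> k * coef f k)"
    then have g: "L2 g" and coef_g: "\<And>k. coef g k = - eigenvalue \<theta> k * coef f k"
      by auto
    \<comment> \<open>The quotient multiplier has modulus at most that of the eigenvalue, so both
      terms of the difference are bounded by \<open>cmod (coef g k)\<close>; squaring the resulting
      factor 2 gives 4.\<close>
    have d_le: "(cmod (?d t k))\<^sup>2 \<le> 4 * (cmod (coef g k))\<^sup>2" if t: "0 < t" for t k
    proof -
      have "Re (- (complex_of_real t * eigenvalue \<theta> k)) \<le> 0"
        using t cos_theta by (simp add: eigenvalue_def lam_def)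
      then have "cmod (exp (- (complex_of_real t * eigenvalue \<theta> k)) - 1) \<le> t * cmod (eigenvalue \<theta> k)"
        using norm_exp_minus_1_le[of "- (complex_of_real t * eigenvalue \<theta> k)"] t by (simp add: norm_mult)
      then have "cmod (exp (- (complex_of_real t * eigenvalue \<theta> k)) - 1) / t \<le> cmod (eigenvalue \<theta> k)"
        using t by (simp add: field_simps)
      then have "cmod (exp (- (complex_of_real t * eigenvalue \<theta> k)) - 1) / t * cmod (coef f k) \<le> cmod (coef g k)"
        unfolding coef_g norm_mult norm_minus_cancel by (rule mult_right_mono) simp
      then have "cmod (?d t k) \<le> 2 * cmod (coef g k)"
        using t norm_triangle_ineq4[of "(exp (- (complex_of_real t * eigenvalue \<theta> k)) - 1) / complex_of_real t * coef f k" "coef g k"]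
        by (simp add: norm_mult norm_divide)
      from power_mono[OF this, of 2] show ?thesis
        by (simp add: power_mult_distrib)
    qed
    have "((\<lambda>t. (L2_norm (?q t))\<^sup>2) \<longlongrightarrow> 0) (at_right 0)"
    proof (rule order_tendstoI)
      fix e :: real assume "e < 0"
      then show "\<forall>\<^sub>F t in at_right 0. e < (L2_norm (?q t))\<^sup>2"
        by (simp add: less_le_trans)
    next
      fix e :: real assume e: "0 < e"
      \<comment> \<open>The tail of g enters with the factor 4, so a squared tail below e / 8 costs
        at most e / 2; the finite head gets the other half.\<close>
      define e' where "e' = sqrt (e / 8)"
      have "0 < e'" using e by (simp add: e'_def)
      from J_expansion_converges[OF g this] obtain F where F: "finite F"
        and tail: "L2_norm (\<lambda>z. g z - (\<Sum>k\<in>F. coef g k * J_pair k z)) < e'"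
        by blast
      have "(L2_norm (\<lambda>z. g z - (\<Sum>k\<in>F. coef g k * J_pair k z)))\<^sup>2 < e'\<^sup>2"
        using tail by (intro power_strict_mono) auto
      then have tail': "(L2_norm g)\<^sup>2 - (\<Sum>k\<in>F. (cmod (coef g k))\<^sup>2) < e / 8"
        using e by (simp add: L2_norm_residual[OF g F] e'_def)
      have "((\<lambda>t. \<Sum>k\<in>F. (cmod (?d t k))\<^sup>2) \<longlongrightarrow> (\<Sum>k\<in>F. (cmod (- eigenvalue \<theta> k * coef f k - coef g k))\<^sup>2)) (at_right 0)"
        by (intro tendsto_sum tendsto_power tendsto_norm d_lim)
      then have "((\<lambda>t. \<Sum>k\<in>F. (cmod (?d t k))\<^sup>2) \<longlongrightarrow> 0) (at_right 0)"
        by (simp add: coef_g)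
      then have "\<forall>\<^sub>F t in at_right 0. (\<Sum>k\<in>F. (cmod (?d t k))\<^sup>2) < e / 2"
        by (rule order_tendstoD) (use e in simp)
      with pos show "\<forall>\<^sub>F t in at_right 0. (L2_norm (?q t))\<^sup>2 < e"
      proof eventually_elim
        case (elim t)
        then have t: "0 \<le> t" by simp
        have "((\<lambda>k. (cmod (?d t k))\<^sup>2) has_sum (L2_norm (?q t))\<^sup>2) UNIV"
          using Parseval[OF L2_difference_quotient[OF t f g]] by (simp add: coef_difference_quotient[OF t f g])
        from has_sum_dominated_le[OF this has_sum_cmult_right[OF Parseval[OF g], of 4] d_le F] \<open>0 < t\<close>
        have "(L2_norm (?q t))\<^sup>2 \<le> (\<Sum>k\<in>F. (cmod (?d t k))\<^sup>2) + 4 * ((L2_norm g)\<^sup>2 - (\<Sum>k\<in>F. (cmod (coef g k))\<^sup>2))"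
          by (simp add: sum_distrib_left right_diff_distrib)
        with elim tail' show ?case by simp
      qed
    qed
    then have "((\<lambda>t. sqrt ((L2_norm (?q t))\<^sup>2)) \<longlongrightarrow> sqrt 0) (at_right 0)"
      by (rule tendsto_real_sqrt)
    then show "gen_is T f g"
      unfolding gen_is_def using f g by simp
  }
qed

end

text \<open>Coefficients are continuous in L2, so the limit of the series has the prescribed ones.
  Conversely, if g has them, the series is the Hermite expansion of g itself.\<close>

lemma L_op_is_iff: "L_op_is \<theta> f g \<longleftrightarrow> L2 g \<and> (\<forall>k. coef g k = - eigenvalue \<theta> k * coef f k)"
proof -
  have sum_eq: "(\<Sum>(m, n)\<in>F. - lam \<theta> m n * L2_inner f (J m n) * J m n z) =
      (\<Sum>k\<in>F. (- eigenvalue \<theta> k * coef f k) * J_pair k z)" for F z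
    by (rule sum.cong[OF refl]) (simp only: split_beta eigenvalue_def coef_def J_pair_def)
  show ?thesis
  proof (intro iffI conjI allI)
    assume L: "L_op_is \<theta> f g"
    then show g: "L2 g" by (simp add: L_op_is_def)
    fix k
    have "cmod (coef g k - (- eigenvalue \<theta> k * coef f k)) < e" if "0 < e" for e
    proof -
      obtain F0 where F0: "finite F0"
        "\<And>F. finite F \<Longrightarrow> F0 \<subseteq> F \<Longrightarrow> L2_norm (\<lambda>z. g z - (\<Sum>k\<in>F. (- eigenvalue \<theta> k * coef f k) * J_pair k z)) < e"
        using L[unfolded L_op_is_def sum_eq, THEN conjunct2, rule_format, OF \<open>0 < e\<close>] by auto
      let ?S = "\<lambda>z. \<Sum>k\<in>insert k F0. (- eigenvalue \<theta> k * coef f k) * J_pair k z"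
      have "coef ?S k = - eigenvalue \<theta> k * coef f k"
        using F0(1) by (subst coef_J_sum) auto
      then have "cmod (coef g k - (- eigenvalue \<theta> k * coef f k)) = cmod (coef (\<lambda>z. g z - ?S z) k)"
        by (simp only: coef_diff[OF g L2_J_sum])
      also have "\<dots> \<le> L2_norm (\<lambda>z. g z - ?S z)"
        by (rule norm_coef_le[OF L2_diff[OF g L2_J_sum]])
      also have "\<dots> < e"
        by (rule F0(2)) (use F0(1) in auto)
      finally show ?thesis .
    qed
    then have "\<not> 0 < cmod (coef g k - (- eigenvalue \<theta> k * coef f k))"
      by blast
    then show "coef g k = - eigenvalue \<theta> k * coef f k" by (simp add: eq_neg_iff_add_eq_0)
  next
    assume "L2 g \<and> (\<forall>k. coef g k = - eigenvalue \<theta> k * coef f k)"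
    then have g: "L2 g" and coef_g: "coef g = (\<lambda>k. - eigenvalue \<theta> k * coef f k)"
      by auto
    show "L_op_is \<theta> f g"
      unfolding L_op_is_def sum_eq by (intro conjI allI impI g J_expansion_converges[OF g, unfolded coef_g])
  qed
qed

lemma L_dom_iff: "L_dom \<theta> f \<longleftrightarrow> L2 f \<and> (\<lambda>k. (cmod (- eigenvalue \<theta> k * coef f k))\<^sup>2) summable_on UNIV"
proof -
  have "(\<lambda>(m, n). (real m ^ 2 + real n ^ 2 + 2 * real m * real n * cos (2 * \<theta>)) * (cmod (L2_inner f (J m n)))\<^sup>2)
      = (\<lambda>k. (cmod (- eigenvalue \<theta> k * coef f k))\<^sup>2)"
    unfolding norm_lam_power2[symmetric]
    by (rule ext) (simp only: split_beta norm_mult norm_minus_cancel power_mult_distrib eigenvalue_def coef_def J_pair_def)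
  then show ?thesis
    unfolding L_dom_def by (simp only:)
qed

theorem theorem4p3:
  fixes \<theta> :: real
    and T :: "real \<Rightarrow> (complex \<Rightarrow> complex) \<Rightarrow> (complex \<Rightarrow> complex)"
  assumes "- (pi / 2) < \<theta>" and "\<theta> < pi / 2"
    and "is_L2_extension_semigroup \<theta> T"
  shows "(\<forall>f. L2 f \<longrightarrow> (gen_dom T f \<longleftrightarrow> L_dom \<theta> f)) \<and>
         (\<forall>f g. L_dom \<theta> f \<longrightarrow> (gen_is T f g \<longleftrightarrow> L_op_is \<theta> f g))"
proof (intro conjI allI impI)
  fix f assume f: "L2 f"
  show "gen_dom T f \<longleftrightarrow> L_dom \<theta> f"
  proof
    \<comment> \<open>Bessel's inequality for the image g is precisely the domain condition on
      f.\<close>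
    assume "gen_dom T f"
    then obtain g where g: "L2 g" "\<And>k. coef g k = - eigenvalue \<theta> k * coef f k"
      unfolding gen_dom_def gen_is_iff[OF assms f] by blast
    then show "L_dom \<theta> f"
      using f Bessel[OF g(1)] unfolding L_dom_iff g(2) by blast
  next
    \<comment> \<open>The domain condition makes the prescribed sequence square-summable, so
      Riesz-Fischer produces the image.\<close>
    assume "L_dom \<theta> f"
    then show "gen_dom T f"
      using Riesz_Fischer[of "\<lambda>k. - eigenvalue \<theta> k * coef f k"]
      unfolding gen_dom_def gen_is_iff[OF assms f] L_dom_iff by blast
  qed
next
  fix f g assume "L_dom \<theta> f"
  then have "L2 f" by (simp add: L_dom_def)
  then show "gen_is T f g \<longleftrightarrow> L_op_is \<theta> f g"
    by (simp only: gen_is_iff[OF assms] L_op_is_iff)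
qed

end
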